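(* Let $k$ be an algebraically closed field of characteristic $p>0$, let $n\ge 1$, let $G=\mathbb{Z}/p^{n}\mathbb{Z}$, and let $V$ be a $G$-representation over $k$ of dimension $d$. The integral $\int_{G\text{-}\mathrm{Cov}(D)}\mathbb{L}^{d-\boldsymbol{v}_V}$ converges if and only if the inequalities $$1-\frac{1}{p^{n-m}}-\sum_{l=m}^{n-1}\frac{D_V^{(l)}}{p^{2n-1-l}}<0\qquad(m=0,1,\dots,n-1)$$ hold.
   Context: Representations are finite-dimensional over $k$. For each $1\le d\le p^n$ there is, up to isomorphism, exactly one indecomposable $G$-representation of dimension $d$ (a generator acts by a single unipotent Jordan block), and every $G$-representation is a direct sum of indecomposables. Invariants. For a positive integer $d\le p^n$ and $0\le m\le n-1$, let $$S_d^{(m)}=\sum_{\substack{0\le i_0+i_1p+\dots+i_{n-1}p^{n-1}<d\\ 0\le i_0,\dots,i_{n-1}<p}} i_m .$$ For $V$ indecomposable of dimension $d$, let $$D_V^{(m)}=p^{n-1}\Big(S_d^{(m)}-(p-1)\sum_{l=m+1}^{n-1}p^{m-l}S_d^{(l)}\Big)\quad(0\le m\le n-1),$$ and extend $D_V^{(m)}$ additively to direct sums. $G$-covers. Let $K=k((t))$ and $D=\operatorname{Spec}k[[t]]$. A $G$-cover of $D$ is the normalization of $D$ in an étale $G$-cover of $\operatorname{Spec}K$; $G\text{-}\mathrm{Cov}(D)$ is the moduli space of $G$-covers of $D$. By Artin–Schreier–Witt theory, $G$-covers correspond bijectively to reduced Witt vectors $\boldsymbol f=(f_0,\dots,f_{n-1})$,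 i.e. each $f_m$ is of the form $\sum_{j>0,\,p\nmid j}a_{m,j}t^{-j}\in k[t^{-1}]$ (finite sum); the cover is defined by $\wp(\boldsymbol g)=\boldsymbol f$, $\wp=\text{Frobenius}-\mathrm{id}$. For $\boldsymbol j=(j_0,\dots,j_{n-1})$ with each $j_m$ either a positive integer prime to $p$ or $-\infty$, $G\text{-}\mathrm{Cov}(D;\boldsymbol j)$ is the set of covers with $\operatorname{ord}f_m=-j_m$ for all $m$ ($j_m=-\infty$ means $f_m=0$). It is identified with $\prod_{j_m\ne-\infty}\mathbb{G}_{m,k}\times_k\mathbb{A}_k^{\,j_m-1-\lfloor j_m/p\rfloor}$, so it has dimension $\sum_{j_m\neq-\infty}(j_m-\lfloor j_m/p\rfloor)$, and $G\text{-}\mathrm{Cov}(D)=\coprod_{\boldsymbol j}G\text{-}\mathrm{Cov}(D;\boldsymbol j)$. A cover is connected iff $j_0\neq-\infty$. The $\boldsymbol v$-function $\boldsymbol v_V$ on $G\text{-}\mathrm{Cov}(D)$ is constant on each stratum and additive in $V$. For $V$ indecomposable of dimension $d$ and $E\in G\text{-}\mathrm{Cov}(D;\boldsymbol j)$ connected, put $u_i=\max\{p^{i-m}j_m\mid 0\le m\le i\}$ and $l_i=u_0+(u_1-u_0)p+\dots+(u_i-u_{i-1})p^i$ (the upper and lower ramification jumps); then $$\boldsymbol v_V(E)=\sum_{\substack{0\le i_0+i_1p+\dots+i_{n-1}p^{n-1}<d\\0\le i_0,\dots,i_{n-1}<p}}\left\lceil\frac{i_0p^{n-1}l_0+i_1p^{n-2}l_1+\dots+i_{n-1}l_{n-1}}{p^n}\right\rceil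 .$$ If $E$ is not connected, with connected component $E'$ having stabilizer $G'\subset G$, then $\boldsymbol v_V(E)=\boldsymbol v_{V'}(E')$, where $V'=V|_{G'}$ and $E'$ is regarded as a $G'$-cover (if $j_0=\dots=j_{r-1}=-\infty\ne j_r$, then $G'$ has order $p^{n-r}$ and $E'$ corresponds to $(f_r,\dots,f_{n-1})$; the trivial cover has value $0$). Integral. With $\mathbb L=[\mathbb A^1_k]$, $$\int_{G\text{-}\mathrm{Cov}(D)}\mathbb L^{d-\boldsymbol v_V}=\sum_{\boldsymbol j}[G\text{-}\mathrm{Cov}(D;\boldsymbol j)]\,\mathbb L^{d-\boldsymbol v_V|_{G\text{-}\mathrm{Cov}(D;\boldsymbol j)}}$$ in the Grothendieck ring of varieties (a version of it) completed with respect to dimension. It converges if the dimensions of the terms tend to $-\infty$: for every integer $N$ only finitely many $\boldsymbol j$ satisfy $\dim G\text{-}\mathrm{Cov}(D;\boldsymbol j)+d-\boldsymbol v_V|_{G\text{-}\mathrm{Cov}(D;\boldsymbol j)}>N$. *)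

theory Defs
  imports
    "HOL-Computational_Algebra.Computational_Algebra"
    "HOL-Algebra.Elementary_Groups"
    "Jordan_Normal_Form.Matrix"
begin

section \<open>Representations of a finite cyclic group\<close>

text \<open>
  A \<open>d\<close>-dimensional representation of \<open>\<int>/q\<int>\<close> over \<open>'k\<close>, in a chosen basis: a group homomorphism
  to \<open>GL\<^sub>d('k)\<close>.  The values outside \<^term>\<open>carrier (integer_mod_group q)\<close> are irrelevant.
\<close>

definition cyclic_rep :: "nat \<Rightarrow> nat \<Rightarrow> (int \<Rightarrow> 'k::field mat) \<Rightarrow> bool" where
  "cyclic_rep q d \<rho> \<longleftrightarrow>
     \<rho> \<in> hom (integer_mod_group q) (units_of (ring_mat TYPE('k) d ()))"

definition rep_iso :: "nat \<Rightarrow> (int \<Rightarrow> 'k::field mat) \<Rightarrow> (int \<Rightarrow> 'k mat) \<Rightarrow> bool" where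
  "rep_iso q \<rho> \<sigma> \<longleftrightarrow>
     (\<exists>P Q. \<forall>g \<in> carrier (integer_mod_group q). similar_mat_wit (\<rho> g) (\<sigma> g) P Q)"

definition rep_sum :: "(int \<Rightarrow> 'k::field mat) list \<Rightarrow> int \<Rightarrow> 'k mat" where
  "rep_sum Ws = (\<lambda>g. diag_block_mat (map (\<lambda>W. W g) Ws))"

definition indecomposable_rep :: "nat \<Rightarrow> nat \<Rightarrow> (int \<Rightarrow> 'k::field mat) \<Rightarrow> bool" where
  "indecomposable_rep q d \<rho> \<longleftrightarrow> cyclic_rep q d \<rho> \<and> d > 0 \<and>
     \<not> (\<exists>a b \<sigma> \<tau>. a > 0 \<and> b > 0 \<and> cyclic_rep q a \<sigma> \<and> cyclic_rep q b \<tau> \<and>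
          rep_iso q \<rho> (rep_sum [\<sigma>, \<tau>]))"

definition has_summand_dims :: "nat \<Rightarrow> (int \<Rightarrow> 'k::field mat) \<Rightarrow> nat list \<Rightarrow> bool" where
  "has_summand_dims q \<rho> ds \<longleftrightarrow>
     (\<exists>Ws. list_all2 (indecomposable_rep q) ds Ws \<and> rep_iso q \<rho> (rep_sum Ws))"

text \<open>
  The dimensions of the summands in a decomposition into indecomposables.  By the Krull-Schmidt
  theorem they are unique up to order, and the list is only used to sum over it.
\<close>

definition summand_dims :: "nat \<Rightarrow> (int \<Rightarrow> 'k::field mat) \<Rightarrow> nat list" where
  "summand_dims q \<rho> = (SOME ds. has_summand_dims q \<rho> ds)"

text \<open>
  The subgroup of index \<open>m\<close> of \<open>\<int>/q\<int>\<close> consists of the multiples of \<open>m\<close>; it is identified with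
  \<open>\<int>/(q/m)\<int>\<close> by \<open>a \<mapsto> m a\<close>.
\<close>

definition restrict_rep :: "nat \<Rightarrow> (int \<Rightarrow> 'k::field mat) \<Rightarrow> int \<Rightarrow> 'k mat" where
  "restrict_rep m \<rho> = (\<lambda>a. \<rho> (int m * a))"

section \<open>The invariants \<open>S\<close> and \<open>D\<close>\<close>

definition digit_vectors :: "nat \<Rightarrow> nat \<Rightarrow> nat \<Rightarrow> (nat \<Rightarrow> nat) set" where
  "digit_vectors p n d = {i \<in> {..<n} \<rightarrow>\<^sub>E {..<p}. (\<Sum>k<n. i k * p ^ k) < d}"

definition S_inv :: "nat \<Rightarrow> nat \<Rightarrow> nat \<Rightarrow> nat \<Rightarrow> nat" where
  "S_inv p n d m = (\<Sum>i \<in> digit_vectors p n d. i m)"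

definition D_indec :: "nat \<Rightarrow> nat \<Rightarrow> nat \<Rightarrow> nat \<Rightarrow> real" where
  "D_indec p n d m =
     real p ^ (n - 1) *
       (real (S_inv p n d m) -
        (real p - 1) * (\<Sum>l = m + 1..<n. real p powi (int m - int l) * real (S_inv p n d l)))"

definition D_inv :: "nat \<Rightarrow> nat \<Rightarrow> (int \<Rightarrow> 'k::field mat) \<Rightarrow> nat \<Rightarrow> real" where
  "D_inv p n \<rho> m = (\<Sum>d \<leftarrow> summand_dims (p ^ n) \<rho>. D_indec p n d m)"

section \<open>Covers\<close>

text \<open>
  A \<open>\<int>/p\<^sup>n\<close>-cover of the formal disk is represented by its reduced Witt vector
  \<open>(f\<^sub>0, \<dots>, f\<^bsub>n-1\<^esub>)\<close> with entries in \<open>k((t))\<close> (Artin-Schreier-Witt theory).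
  Formal Laurent series have only finitely many negative exponents, so the finiteness of the sums \<open>\<Sum> a\<^sub>j t\<^bsup>-j\<^esup>\<close> is automatic.
\<close>

definition reduced :: "nat \<Rightarrow> 'k::field fls \<Rightarrow> bool" where
  "reduced p f \<longleftrightarrow> (\<forall>e. fls_nth f e \<noteq> 0 \<longrightarrow> e < 0 \<and> \<not> int p dvd e)"

definition GCov :: "nat \<Rightarrow> nat \<Rightarrow> 'k::field fls list set" where
  "GCov p n = {E. length E = n \<and> (\<forall>f \<in> set E. reduced p f)}"

text \<open>The number \<open>j\<close> with \<open>ord f = -j\<close>; here and below \<^term>\<open>None\<close> stands for \<open>j = -\<infinity>\<close>.\<close>

definition pole_order :: "'k::field fls \<Rightarrow> nat option" where
  "pole_order f = (if f = 0 then None else Some (nat (- fls_subdegree f)))"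

definition strata_indices :: "nat \<Rightarrow> nat \<Rightarrow> nat option list set" where
  "strata_indices p n =
     {j. length j = n \<and> (\<forall>x. Some x \<in> set j \<longrightarrow> x > 0 \<and> \<not> p dvd x)}"

definition GCov_stratum :: "nat \<Rightarrow> nat \<Rightarrow> nat option list \<Rightarrow> 'k::field fls list set" where
  "GCov_stratum p n j = {E \<in> GCov p n. map pole_order E = j}"

text \<open>
  The dimension of \<open>\<Prod> \<bbbG>\<^sub>m \<times> \<bbbA>\<^bsup>j\<^sub>m - 1 - \<lfloor>j\<^sub>m/p\<rfloor>\<^esup>\<close>, the product over
  all \<open>m\<close> with \<open>j\<^sub>m \<noteq> -\<infinity>\<close>: the leading coefficient of \<open>f\<^sub>m\<close> ranges over \<open>\<bbbG>\<^sub>m\<close>, the coefficients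
  of the \<open>t\<^bsup>-i\<^esup>\<close> with \<open>0 < i < j\<^sub>m\<close> prime to \<open>p\<close> over the affine space.
\<close>

definition stratum_dim :: "nat \<Rightarrow> nat option list \<Rightarrow> nat" where
  "stratum_dim p j =
     (\<Sum>x \<leftarrow> j. case x of None \<Rightarrow> 0 | Some a \<Rightarrow> 1 + (a - 1 - a div p))"

section \<open>The \<open>v\<close>-function\<close>

text \<open>Upper and lower ramification jumps of a connected cover, that is, for \<open>j\<^sub>0 \<noteq> -\<infinity>\<close>.\<close>

definition upper_jump :: "nat \<Rightarrow> nat option list \<Rightarrow> nat \<Rightarrow> int" where
  "upper_jump p j i = Max {int (p ^ (i - m) * a) | m a. m \<le> i \<and> j ! m = Some a}"

definition lower_jump :: "nat \<Rightarrow> nat option list \<Rightarrow> nat \<Rightarrow> int" where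
  "lower_jump p j i =
     upper_jump p j 0 + (\<Sum>m = 1..i. (upper_jump p j m - upper_jump p j (m - 1)) * int p ^ m)"

definition v_indec :: "nat \<Rightarrow> nat \<Rightarrow> nat \<Rightarrow> nat option list \<Rightarrow> int" where
  "v_indec p n d j =
     (\<Sum>i \<in> digit_vectors p n d.
        \<lceil>real_of_int (\<Sum>k<n. int (i k) * int p ^ (n - 1 - k) * lower_jump p j k) / real p ^ n\<rceil>)"

definition v_connected :: "nat \<Rightarrow> nat \<Rightarrow> (int \<Rightarrow> 'k::field mat) \<Rightarrow> 'k fls list \<Rightarrow> int" where
  "v_connected p n \<rho> E = (\<Sum>d \<leftarrow> summand_dims (p ^ n) \<rho>. v_indec p n d (map pole_order E))"

text \<open>
  With \<open>r\<close> the least index such that \<open>f\<^sub>r \<noteq> 0\<close>, a connected component of the cover is the cover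
  with group \<open>\<int>/p\<^bsup>n-r\<^esup>\<close> given by \<open>(f\<^sub>r, \<dots>, f\<^bsub>n-1\<^esub>)\<close>.  For a connected cover \<open>r = 0\<close>.
\<close>

definition v_fun :: "nat \<Rightarrow> nat \<Rightarrow> (int \<Rightarrow> 'k::field mat) \<Rightarrow> 'k fls list \<Rightarrow> int" where
  "v_fun p n \<rho> E =
     (if \<forall>f \<in> set E. f = 0 then 0
      else let r = (LEAST r. r < n \<and> E ! r \<noteq> 0)
           in v_connected p (n - r) (restrict_rep (p ^ r) \<rho>) (drop r E))"

section \<open>Convergence of the integral\<close>

text \<open>
  The term of index \<open>j\<close> of \<open>\<integral> \<bbbL>\<^bsup>d - v\<^esup>\<close> has dimension \<open>dim GCov(D; j) + d - v\<close>.  Since \<open>v\<close> is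
  constant on the nonempty stratum of \<open>j\<close>, any cover \<open>E\<close> in it gives the value of \<open>v\<close>.
  Convergence means that these dimensions tend to \<open>-\<infinity>\<close>.
\<close>

definition integral_converges :: "nat \<Rightarrow> nat \<Rightarrow> nat \<Rightarrow> (int \<Rightarrow> 'k::field mat) \<Rightarrow> bool" where
  "integral_converges p n d \<rho> \<longleftrightarrow>
     (\<forall>N::int. finite {j \<in> strata_indices p n.
        \<exists>E \<in> GCov_stratum p n j. int (stratum_dim p j) + int d - v_fun p n \<rho> E > N})"

end

theory Submission
  imports
    Defs
    "Jordan_Normal_Form.Jordan_Normal_Form_Existence"
    "Jordan_Normal_Form.Jordan_Normal_Form_Uniqueness"
begin

text \<open>
  Write \<open>l\<^sub>i\<close> in terms of the upper jumps \<open>u\<^sub>m\<close>.  Up to the rounding, which is bounded on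
  all strata, \<open>v\<^sub>V = \<Sum>\<^sub>m u\<^sub>m D\<^sub>V\<^bsup>(m)\<^esup> / p\<^sup>n\<close> on connected covers, and the dimension of a stratum is
  \<open>(1 - 1/p) \<Sum>\<^sub>m j\<^sub>m\<close> up to a bounded error.  As \<open>j\<^sub>m \<le> u\<^sub>m\<close>, with a difference of at most \<open>1\<close> for the
  best choice of \<open>j\<^sub>m\<close>, the largest dimensions are \<open>\<Sum>\<^sub>m c\<^sub>m u\<^sub>m + O(1)\<close> with
  \<open>c\<^sub>m = 1 - 1/p - D\<^sub>V\<^bsup>(m)\<^esup> / p\<^sup>n\<close>.  The increments \<open>w\<^sub>m = u\<^sub>m - p u\<^bsub>m-1\<^esub>\<close> are nonnegative and essentially
  arbitrary, and the coefficient of \<open>w\<^sub>m\<close> is \<open>p\<^bsup>n-1-m\<^esup>\<close> times the left-hand side of the \<open>m\<close>-th inequality.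

  For a cover that is not connected, with stabilizer of index \<open>p\<^sup>r\<close>, the restriction \<open>V'\<close> satisfies
  \<open>S\<^bsub>V'\<^esub>\<^bsup>(m)\<^esup> = S\<^sub>V\<^bsup>(m+r)\<^esup>\<close>, as restricting a Jordan block sends its basis index \<open>x\<close> to
  \<open>x div p\<^sup>r\<close>.  So the inequalities for \<open>V'\<close> are those for \<open>V\<close> with \<open>m \<ge> r\<close>.
\<close>

section \<open>Matrices in prime characteristic\<close>

text \<open>Since \<open>1\<close> and \<open>X\<close> commute, this is the binomial theorem.
  Taking entries turns it into sums of scalars, where coefficients can be reduced modulo the
  characteristic.\<close>

lemma pow_one_plus_mat_index:
  fixes X :: "'a::comm_ring_1 mat"
  assumes X: "X \<in> carrier_mat n n" and "a < n" "b < n"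
  shows "((1\<^sub>m n + X) ^\<^sub>m k) $$ (a, b) = (\<Sum>i\<le>k. of_nat (k choose i) * (X ^\<^sub>m i) $$ (a, b))"
  using assms(2,3)
proof (induction k arbitrary: a b)
  case 0
  then show ?case using X by simp
next
  case (Suc k)
  let ?Y = "1\<^sub>m n + X"
  have XC: "X ^\<^sub>m i \<in> carrier_mat n n" for i using X by auto
  have Y: "?Y \<in> carrier_mat n n" "?Y ^\<^sub>m k \<in> carrier_mat n n" using X by auto
  have "?Y ^\<^sub>m Suc k = ?Y ^\<^sub>m k + ?Y ^\<^sub>m k * X"
    using X Y by (simp add: mult_add_distrib_mat[of _ n n _ n])
  then have "(?Y ^\<^sub>m Suc k) $$ (a,b) = (?Y ^\<^sub>m k) $$ (a,b) + (\<Sum>c<n. (?Y ^\<^sub>m k) $$ (a,c) * X $$ (c,b))"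
    using X Y Suc.prems by (simp add: scalar_prod_def lessThan_atLeast0)
  also have "(\<Sum>c<n. (?Y ^\<^sub>m k) $$ (a,c) * X $$ (c,b)) 
     = (\<Sum>c<n. \<Sum>i\<le>k. of_nat (k choose i) * ((X ^\<^sub>m i) $$ (a, c) * X $$ (c,b)))"
    using Suc by (intro sum.cong refl) (simp add: sum_distrib_right mult.assoc)
  also have "\<dots> = (\<Sum>i\<le>k. of_nat (k choose i) * (\<Sum>c<n. (X ^\<^sub>m i) $$ (a, c) * X $$ (c,b)))"
    by (subst sum.swap) (simp add: sum_distrib_left)
  also have "\<dots> = (\<Sum>i\<le>k. of_nat (k choose i) * (X ^\<^sub>m Suc i) $$ (a, b))"
    using X XC Suc.prems by (simp add: scalar_prod_def lessThan_atLeast0)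
  also have "(?Y ^\<^sub>m k) $$ (a,b) = (\<Sum>i\<le>k. of_nat (k choose i) * (X ^\<^sub>m i) $$ (a, b))"
    using Suc by simp
  \<comment> \<open>The added term at \<open>Suc k\<close> has coefficient \<open>0\<close>. With it
    the two sums combine by Pascal's rule, once the term at \<open>0\<close> is split off.\<close>
  also have "\<dots> = (\<Sum>i\<le>Suc k. of_nat (k choose i) * (X ^\<^sub>m i) $$ (a, b))"
    by (simp add: binomial_eq_0)
  also have "\<dots> = (X ^\<^sub>m 0) $$ (a,b) + (\<Sum>i\<le>k. of_nat (k choose Suc i) * (X ^\<^sub>m Suc i) $$ (a, b))"
    by (subst sum.atMost_Suc_shift) simp
  finally have "(?Y ^\<^sub>m Suc k) $$ (a,b) = (X ^\<^sub>m 0) $$ (a,b)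
      + (\<Sum>i\<le>k. of_nat (Suc k choose Suc i) * (X ^\<^sub>m Suc i) $$ (a, b))"
    by (simp add: sum.distrib algebra_simps del: pow_mat.simps)
  also have "\<dots> = (\<Sum>i\<le>Suc k. of_nat (Suc k choose i) * (X ^\<^sub>m i) $$ (a, b))"
    by (subst sum.atMost_Suc_shift) simp
  finally show ?case .
qed

text \<open>All inner binomial coefficients are divisible by the characteristic, so only the two
  extreme terms survive.\<close>

lemma one_plus_mat_pow_CHAR:
  fixes X :: "'a::comm_ring_1 mat"
  assumes X: "X \<in> carrier_mat n n" and p: "prime CHAR('a)"
  shows "(1\<^sub>m n + X) ^\<^sub>m CHAR('a) = 1\<^sub>m n + X ^\<^sub>m CHAR('a)"
proof (rule eq_matI)
  let ?p = "CHAR('a)"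
  fix a b assume "a < dim_row (1\<^sub>m n + X ^\<^sub>m ?p)" "b < dim_col (1\<^sub>m n + X ^\<^sub>m ?p)"
  with X prime_gt_0_nat[OF p] have ab: "a < n" "b < n" by auto
  have "((1\<^sub>m n + X) ^\<^sub>m ?p) $$ (a, b) = (\<Sum>i\<le>?p. of_nat (?p choose i) * (X ^\<^sub>m i) $$ (a, b))"
    by (rule pow_one_plus_mat_index[OF X ab])
  also have "\<dots> = (\<Sum>i\<in>{0, ?p}. of_nat (?p choose i) * (X ^\<^sub>m i) $$ (a, b))"
  proof (intro sum.mono_neutral_right ballI)
    fix i assume "i \<in> {..?p} - {0, ?p}"
    then have "0 < i" "i < ?p" by auto
    then have "?p dvd (?p choose i)"
      using p by (intro dvd_choose_prime) auto
    then have "of_nat (?p choose i) = (0 :: 'a)" by (simp add: of_nat_eq_0_iff_char_dvd)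
    then show "of_nat (?p choose i) * (X ^\<^sub>m i) $$ (a, b) = 0" by simp
  qed auto
  also have "\<dots> = (1\<^sub>m n + X ^\<^sub>m ?p) $$ (a, b)"
    using p X ab prime_gt_0_nat[OF p] by simp
  finally show "((1\<^sub>m n + X) ^\<^sub>m ?p) $$ (a, b) = (1\<^sub>m n + X ^\<^sub>m ?p) $$ (a, b)" .
qed (use X in auto)

lemma pow_mat_add:
  assumes "A \<in> carrier_mat n n"
  shows "A ^\<^sub>m (k + l) = A ^\<^sub>m k * A ^\<^sub>m l"
proof -
  from assms have "A ^\<^sub>m k \<in> carrier_mat n n" for k by auto
  with assms show ?thesis
    by (induction l) (auto simp: assoc_mult_mat[of _ n n _ n _ n])
qed

lemma pow_mat_mult:
  assumes "A \<in> carrier_mat n n"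
  shows "A ^\<^sub>m (k * l) = (A ^\<^sub>m k) ^\<^sub>m l"
proof (induction l)
  case (Suc l)
  have "A ^\<^sub>m (k * Suc l) = A ^\<^sub>m (k * l) * A ^\<^sub>m k"
    using pow_mat_add[OF assms, of "k * l" k] by (simp add: add.commute)
  then show ?case using Suc by simp
qed (use assms in auto)

lemma pow_mat_one: "1\<^sub>m n ^\<^sub>m k = (1\<^sub>m n :: 'a::semiring_1 mat)"
  by (induction k) auto

lemma one_plus_mat_pow_CHAR_power:
  fixes X :: "'a::comm_ring_1 mat"
  assumes X: "X \<in> carrier_mat n n" and p: "prime CHAR('a)"
  shows "(1\<^sub>m n + X) ^\<^sub>m (CHAR('a) ^ r) = 1\<^sub>m n + X ^\<^sub>m (CHAR('a) ^ r)"
proof (induction r)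
  case (Suc r)
  have "(1\<^sub>m n + X) ^\<^sub>m (CHAR('a) ^ Suc r) = ((1\<^sub>m n + X) ^\<^sub>m (CHAR('a) ^ r)) ^\<^sub>m CHAR('a)"
    unfolding power_Suc2 using X by (intro pow_mat_mult[of _ n]) auto
  also have "\<dots> = (1\<^sub>m n + X ^\<^sub>m (CHAR('a) ^ r)) ^\<^sub>m CHAR('a)" by (simp only: Suc)
  also have "\<dots> = 1\<^sub>m n + (X ^\<^sub>m (CHAR('a) ^ r)) ^\<^sub>m CHAR('a)"
    using X p by (intro one_plus_mat_pow_CHAR) auto
  also have "(X ^\<^sub>m (CHAR('a) ^ r)) ^\<^sub>m CHAR('a) = X ^\<^sub>m (CHAR('a) ^ Suc r)"
    unfolding power_Suc2 using X by (intro pow_mat_mult[of _ n, symmetric]) auto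
  finally show ?case .
qed (use X in auto)

text \<open>As \<open>char_matrix A 1\<close> is \<open>A - 1\<close>, this says
  \<open>(A - 1)^q = A^q - 1\<close> for a power \<open>q\<close> of the characteristic. It relates
  the generalized eigenspaces of a generator to those of its \<open>q\<close>-th power.\<close>

lemma char_matrix_pow_CHAR_power:
  fixes A :: "'a::field mat"
  assumes A: "A \<in> carrier_mat n n" and p: "prime CHAR('a)"
  shows "char_matrix (A ^\<^sub>m (CHAR('a) ^ r)) 1 = char_matrix A 1 ^\<^sub>m (CHAR('a) ^ r)"
proof -
  let ?X = "char_matrix A 1" and ?q = "CHAR('a) ^ r"
  have X: "?X \<in> carrier_mat n n" using A by simp
  have AX: "A = 1\<^sub>m n + ?X" using A by (intro eq_matI) (auto simp: char_matrix_def)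
  have "A ^\<^sub>m ?q = 1\<^sub>m n + ?X ^\<^sub>m ?q"
    by (subst AX, rule one_plus_mat_pow_CHAR_power[OF X p])
  moreover have "char_matrix (1\<^sub>m n + Y) 1 = Y" if "Y \<in> carrier_mat n n" for Y :: "'a mat"
    using that by (intro eq_matI) (auto simp: char_matrix_def)
  ultimately show ?thesis
    using X by simp
qed

section \<open>Triangular and Jordan form over an algebraically closed field\<close>

text \<open>
  The library's Schur decomposition needs an ordered field with conjugation.  Over a general
  field, Gauss-Jordan elimination of the singular matrix \<open>A - a\<close> gives a conjugate of \<open>A - a\<close>
  with vanishing last row, and one recurses on the upper left block.
\<close>

lemma similar_mat_triangular:
  fixes A :: "'a::alg_closed_field mat"
  assumes "A \<in> carrier_mat n n"
  shows "\<exists>T \<in> carrier_mat n n. upper_triangular T \<and> similar_mat A T"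
  using assms
proof (induction n arbitrary: A)
  case 0
  then show ?case by (intro bexI[of _ A]) (auto intro: similar_mat_refl)
next
  case (Suc n)
  note A = Suc.prems
  let ?N = "Suc n"
  have "degree (char_poly A) > 0" using degree_monic_char_poly[OF A] by simp
  then obtain a where "poly (char_poly A) a = 0" using alg_closed_imp_poly_has_root by blast
  then have det0: "det (char_matrix A a) = 0"
    using A eigenvalue_root_char_poly eigenvalue_det by blast
  define C where "C = char_matrix A a"
  have C: "C \<in> carrier_mat ?N ?N" using A by (simp add: C_def)
  obtain R B where g: "gauss_jordan C (1\<^sub>m ?N) = (R, B)" by force
  obtain P where PU: "P \<in> Units (ring_mat TYPE('a) ?N ())" and R: "R = P * C"
    using gauss_jordan_transform[OF C one_carrier_mat g, of "()"] by auto
  have RC: "R \<in> carrier_mat ?N ?N" using gauss_jordan_carrier(1)[OF C one_carrier_mat g] .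
  from PU obtain Q where P: "P \<in> carrier_mat ?N ?N" and Q: "Q \<in> carrier_mat ?N ?N"
    and PQ: "P * Q = 1\<^sub>m ?N" "Q * P = 1\<^sub>m ?N"
    by (auto simp: Units_def ring_mat_def)
  have "R \<noteq> 1\<^sub>m ?N"
  proof
    assume "R = 1\<^sub>m ?N"
    then have "det (P * C) = 1" using R by simp
    then show False using det0 P C by (simp add: det_mult C_def)
  qed
  then have row: "row R n = 0\<^sub>v ?N"
    using row_echelon_form_imp_1_or_0_row[OF RC gauss_jordan_row_echelon[OF C g]] by auto
  define M where "M = P * A * Q"
  have M: "M \<in> carrier_mat ?N ?N" using P A Q by (simp add: M_def)
  have AC: "A = C + a \<cdot>\<^sub>m 1\<^sub>m ?N" using A by (intro eq_matI) (auto simp: C_def char_matrix_def)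
  have "M = P * C * Q + a \<cdot>\<^sub>m 1\<^sub>m ?N"
    unfolding M_def by (subst AC) (use P C Q PQ in \<open>simp add: mult_add_distrib_mat[of _ ?N ?N _ ?N] 
       add_mult_distrib_mat[of _ ?N ?N _ _ ?N] mult_smult_distrib[of _ ?N ?N _ ?N] mult_smult_assoc_mat[of _ ?N ?N _ ?N]\<close>)
  then have MR: "M = R * Q + a \<cdot>\<^sub>m 1\<^sub>m ?N" by (simp add: R)
  \<comment> \<open>The last row of \<open>R * Q\<close> vanishes with that of \<open>R\<close>, and
    the scalar part only changes the diagonal entry, which \<open>j < n\<close> excludes.\<close>
  have last_row: "M $$ (n, j) = 0" if "j < n" for j
  proof -
    have "M $$ (n, j) = row R n \<bullet> col Q j" using that RC Q by (simp add: MR)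
    also have "\<dots> = 0" unfolding row using that Q by (simp add: scalar_prod_def)
    finally show ?thesis .
  qed
  define A1 where "A1 = mat n n (\<lambda>ij. M $$ ij)"
  define A0 where "A0 = mat n 1 (\<lambda>(i,j). M $$ (i, n))"
  define A2 where "A2 = mat 1 1 (\<lambda>(i,j). M $$ (n, n))"
  have M4: "M = four_block_mat A1 A0 (0\<^sub>m 1 n) A2"
    using M last_row by (intro eq_matI) (auto simp: A1_def A0_def A2_def less_Suc_eq)
  obtain T where T: "T \<in> carrier_mat n n" "upper_triangular T" "similar_mat A1 T"
    using Suc.IH[of A1] by (auto simp: A1_def)
  \<comment> \<open>The similarity of \<open>A1\<close> and \<open>T\<close> extends to the block
    matrices at the cost of changing the upper right column.\<close>
  obtain B0 where B0: "B0 \<in> carrier_mat n 1"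
    "similar_mat (four_block_mat A1 A0 (0\<^sub>m 1 n) A2) (four_block_mat T B0 (0\<^sub>m 1 n) A2)"
    using similar_mat_four_block_0_ex[OF T(3) similar_mat_refl, of A2 1 A0 n 1]
    by (auto simp: A0_def A1_def A2_def)
  have "similar_mat A M"
  proof (rule similar_matI)
    show "{A, M, Q, P} \<subseteq> carrier_mat ?N ?N" using A M P Q by auto
    have "Q * M * P = (Q * P) * A * (Q * P)"
      unfolding M_def using A P Q by (simp add: assoc_mult_mat[of _ ?N ?N _ ?N _ ?N])
    then show "A = Q * M * P" using A PQ by simp
  qed (use PQ in auto)
  with B0(2) have "similar_mat A (four_block_mat T B0 (0\<^sub>m 1 n) A2)"
    unfolding M4 by (rule similar_mat_trans[rotated])
  moreover have "upper_triangular (four_block_mat T B0 (0\<^sub>m 1 n) A2)"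
    using T B0(1) by (auto simp: upper_triangular_def A2_def)
  moreover have "four_block_mat T B0 (0\<^sub>m 1 n) A2 \<in> carrier_mat ?N ?N"
    using T B0(1) by (auto simp: A2_def)
  ultimately show ?case by blast
qed

lemma jordan_nf_exists_alg_closed:
  fixes A :: "'a::alg_closed_field mat"
  assumes "A \<in> carrier_mat n n"
  shows "\<exists>n_as. jordan_nf A n_as"
  using similar_mat_triangular[OF assms] triangular_to_jnf_vector similar_mat_trans
  unfolding jordan_nf_def by metis

section \<open>Representations of cyclic groups\<close>

lemma units_ring_mat_group: "Group.group (units_of (ring_mat TYPE('k::field) d ()))"
proof -
  interpret ring "ring_mat TYPE('k) d ()" by (rule ring_mat)
  show ?thesis by (rule units_group)
qed

lemma cyclic_rep_carrier:
  assumes "cyclic_rep q d \<rho>" "g \<in> carrier (integer_mod_group q)"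
  shows "\<rho> g \<in> carrier_mat d d"
  using assms by (auto simp: cyclic_rep_def hom_def units_of_def Units_def ring_mat_def)

text \<open>A representation of a cyclic group is determined by the matrix of the generator
  \<open>1\<close>, which lies in the carrier as \<open>q > 1\<close>. Later comparisons of
  representations reduce to this matrix.\<close>

lemma cyclic_rep_power:
  fixes \<rho> :: "int \<Rightarrow> 'k::field mat"
  assumes \<rho>: "cyclic_rep q d \<rho>" and q: "q > 1"
  shows "\<rho> (int k mod int q) = \<rho> 1 ^\<^sub>m k"
proof (induction k)
  case 0
  have "\<rho> (\<one>\<^bsub>integer_mod_group q\<^esub>) = \<one>\<^bsub>units_of (ring_mat TYPE('k) d ())\<^esub>"
    using \<rho> by (intro hom_one) (auto simp: cyclic_rep_def units_ring_mat_group)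
  moreover have "\<rho> 1 \<in> carrier_mat d d"
    using q by (intro cyclic_rep_carrier[OF \<rho>]) simp
  ultimately show ?case by (simp add: units_of_def ring_mat_def)
next
  case (Suc k)
  have "\<rho> ((int k mod int q) \<otimes>\<^bsub>integer_mod_group q\<^esub> 1)
     = \<rho> (int k mod int q) \<otimes>\<^bsub>units_of (ring_mat TYPE('k) d ())\<^esub> \<rho> 1"
    using \<rho> q by (intro hom_mult[of \<rho>]) (auto simp: cyclic_rep_def carrier_integer_mod_group)
  moreover have "((int k mod int q) + 1) mod int q = int (Suc k) mod int q"
    by (simp add: mod_simps add.commute)
  ultimately show ?case by (simp add: Suc units_of_def ring_mat_def)
qed

lemma cyclic_rep_generates:
  assumes "cyclic_rep q d \<rho>" "q > 1" "g \<in> carrier (integer_mod_group q)"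
  shows "\<rho> g = \<rho> 1 ^\<^sub>m nat g"
  using cyclic_rep_power[OF assms(1,2), of "nat g"] assms(2,3)
  by (simp add: carrier_integer_mod_group)

lemma cyclic_rep_generator_order:
  assumes \<rho>: "cyclic_rep q d \<rho>" and q: "q > 1"
  shows "\<rho> 1 \<in> carrier_mat d d" "\<rho> 1 ^\<^sub>m q = 1\<^sub>m d"
proof -
  show c: "\<rho> 1 \<in> carrier_mat d d"
    using q by (intro cyclic_rep_carrier[OF \<rho>]) simp
  show "\<rho> 1 ^\<^sub>m q = 1\<^sub>m d"
    using cyclic_rep_power[OF \<rho> q, of q] cyclic_rep_power[OF \<rho> q, of 0] c by simp
qed

lemma cyclic_rep_powers:
  fixes A :: "'k::field mat"
  assumes A: "A \<in> carrier_mat d d" and Aq: "A ^\<^sub>m q = 1\<^sub>m d" and q: "q > 0"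
  shows "cyclic_rep q d (\<lambda>g. A ^\<^sub>m nat g)"
proof -
  have pow_mod: "A ^\<^sub>m k = A ^\<^sub>m (k mod q)" for k
  proof -
    have "A ^\<^sub>m k = A ^\<^sub>m (q * (k div q) + k mod q)" by simp
    also have "\<dots> = (A ^\<^sub>m q) ^\<^sub>m (k div q) * A ^\<^sub>m (k mod q)"
      by (simp only: pow_mat_add[OF A] pow_mat_mult[OF A])
    also have "\<dots> = A ^\<^sub>m (k mod q)" using A by (simp add: Aq pow_mat_one)
    finally show ?thesis .
  qed
  have unit: "A ^\<^sub>m k \<in> Units (ring_mat TYPE('k) d ())" for k
  proof -
    \<comment> \<open>As \<open>q > 0\<close>, the difference \<open>q * k - k\<close> is not
      truncated, and the two exponents add up to a multiple of \<open>q\<close>. This gives the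
      inverse.\<close>
    have "A ^\<^sub>m k * A ^\<^sub>m (q * k - k) = 1\<^sub>m d \<and> A ^\<^sub>m (q * k - k) * A ^\<^sub>m k = 1\<^sub>m d"
      using q by (simp add: pow_mat_mult[OF A] Aq pow_mat_one flip: pow_mat_add[OF A])
    then show ?thesis using A by (auto simp: Units_def ring_mat_def intro!: bexI[of _ "A ^\<^sub>m (q * k - k)"])
  qed
  have "A ^\<^sub>m nat ((x + y) mod int q) = A ^\<^sub>m nat x * A ^\<^sub>m nat y" if "0 \<le> x" "0 \<le> y" for x y
    using that by (simp add: nat_mod_distrib nat_add_distrib flip: pow_mod pow_mat_add[OF A])
  then show ?thesis using unit q
    by (auto simp: cyclic_rep_def hom_def units_of_def carrier_integer_mod_group) (auto simp: ring_mat_def)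
qed

lemma rep_sum_generates:
  assumes "\<forall>W \<in> set Ws. \<exists>e. cyclic_rep q e W" "q > 1" "g \<in> carrier (integer_mod_group q)"
  shows "rep_sum Ws g = rep_sum Ws 1 ^\<^sub>m nat g"
proof -
  have "square_mat (W 1)" if "W \<in> set Ws" for W
    using assms(1) that cyclic_rep_generator_order(1)[OF _ assms(2)] by (metis carrier_matD square_mat.simps)
  then have "rep_sum Ws 1 ^\<^sub>m nat g = diag_block_mat (map (\<lambda>A. A ^\<^sub>m nat g) (map (\<lambda>W. W 1) Ws))"
    unfolding rep_sum_def by (intro diag_block_pow_mat) simp
  also have "map (\<lambda>A. A ^\<^sub>m nat g) (map (\<lambda>W. W 1) Ws) = map (\<lambda>W. W g) Ws"
    using assms(1) cyclic_rep_generates[OF _ assms(2,3)] by (fastforce simp del: pow_mat.simps)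
  also have "diag_block_mat \<dots> = rep_sum Ws g"
    unfolding rep_sum_def ..
  finally show ?thesis by simp
qed

text \<open>The pair \<open>P\<close>, \<open>Q\<close> that conjugates the generators also
  conjugates all their powers.\<close>

lemma rep_isoI:
  assumes "cyclic_rep q d \<rho>" "\<forall>W \<in> set Ws. \<exists>e. cyclic_rep q e W" "q > 1"
    and "similar_mat (\<rho> 1) (rep_sum Ws 1)"
  shows "rep_iso q \<rho> (rep_sum Ws)"
proof -
  from assms(4) obtain P Q where "similar_mat_wit (\<rho> 1) (rep_sum Ws 1) P Q"
    by (auto simp: similar_mat_def)
  then have "similar_mat_wit (\<rho> g) (rep_sum Ws g) P Q" if "g \<in> carrier (integer_mod_group q)" for g
    unfolding cyclic_rep_generates[OF assms(1,3) that] rep_sum_generates[OF assms(2,3) that]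
    by (rule similar_mat_wit_pow)
  then show ?thesis unfolding rep_iso_def by blast
qed

lemma rep_isoD: "rep_iso q \<rho> \<sigma> \<Longrightarrow> q > 1 \<Longrightarrow> similar_mat (\<rho> 1) (\<sigma> 1)"
  unfolding rep_iso_def similar_mat_def by (metis integer_mod_group_1 less_irrefl)

section \<open>Decomposition into indecomposables\<close>

lemma diag_block_mat_pair:
  "diag_block_mat [A, B] =
     four_block_mat A (0\<^sub>m (dim_row A) (dim_col B)) (0\<^sub>m (dim_row B) (dim_col A)) B"
  unfolding diag_block_mat.simps(2)[of A "[B]"] diag_block_mat_singleton Let_def ..

lemma rep_sum_append:
  "rep_sum (Vs @ Ws) g = diag_block_mat [rep_sum Vs g, rep_sum Ws g]"
  unfolding diag_block_mat_pair by (simp add: rep_sum_def diag_block_mat_append Let_def)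

text \<open>Splitting a decomposable representation lowers the dimension, so strong induction ends
  in indecomposables. This makes the choice in \<open>summand_dims\<close> meaningful.\<close>

lemma has_summand_dims_exists:
  assumes "cyclic_rep q d \<rho>" "q > 1"
  shows "\<exists>ds. has_summand_dims q \<rho> ds"
  using assms(1)
proof (induction d arbitrary: \<rho> rule: less_induct)
  case (less d)
  note \<rho> = less.prems
  consider "d = 0" | "indecomposable_rep q d \<rho>"
    | a b \<sigma> \<tau> where "d > 0" "a > 0" "b > 0" "cyclic_rep q a \<sigma>" "cyclic_rep q b \<tau>"
        "rep_iso q \<rho> (rep_sum [\<sigma>, \<tau>])"
    using \<rho> unfolding indecomposable_rep_def by blast
  then show ?case
  proof cases
    \<comment> \<open>The zero representation is the empty sum, because indecomposables have
      positive dimension.\<close>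
    case 1
    have "\<rho> 1 = 0\<^sub>m 0 0" using cyclic_rep_generator_order(1)[OF \<rho> assms(2)] 1 by auto
    then have "rep_iso q \<rho> (rep_sum [])"
      using \<rho> assms(2) by (intro rep_isoI) (auto simp: rep_sum_def intro: similar_mat_refl[of _ 0])
    then show ?thesis unfolding has_summand_dims_def by (intro exI[of _ "[]"]) auto
  next
    case 2
    have "rep_iso q \<rho> (rep_sum [\<rho>])"
      using \<rho> assms(2) cyclic_rep_generator_order(1)[OF \<rho> assms(2)]
      by (intro rep_isoI) (auto simp: rep_sum_def intro: similar_mat_refl simp del: diag_block_mat.simps)
    then show ?thesis using 2 unfolding has_summand_dims_def
      by (intro exI[of _ "[d]"] exI[of _ "[\<rho>]"]) auto
  next
    case (3 a b \<sigma> \<tau>)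
    have sim: "similar_mat (\<rho> 1) (diag_block_mat [\<sigma> 1, \<tau> 1])"
      using rep_isoD[OF 3(6) assms(2)] by (simp add: rep_sum_def del: diag_block_mat.simps)
    have "\<sigma> 1 \<in> carrier_mat a a" "\<tau> 1 \<in> carrier_mat b b"
      using 3 cyclic_rep_generator_order(1) assms(2) by blast+
    moreover have "\<rho> 1 \<in> carrier_mat d d"
      using cyclic_rep_generator_order(1)[OF \<rho> assms(2)] .
    ultimately have "d = a + b"
    proof -
      obtain m P Q where "{\<rho> 1, diag_block_mat [\<sigma> 1, \<tau> 1], P, Q} \<subseteq> carrier_mat m m"
        using similar_matD[OF sim] by blast
      then have "dim_row (\<rho> 1) = dim_row (diag_block_mat [\<sigma> 1, \<tau> 1])" by auto
      moreover assume "\<sigma> 1 \<in> carrier_mat a a" "\<tau> 1 \<in> carrier_mat b b" "\<rho> 1 \<in> carrier_mat d d"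
      ultimately show ?thesis by (simp add: dim_diag_block_mat del: diag_block_mat.simps)
    qed
    with 3 obtain ds es Vs Ws where
      V: "list_all2 (indecomposable_rep q) ds Vs" "rep_iso q \<sigma> (rep_sum Vs)" and
      W: "list_all2 (indecomposable_rep q) es Ws" "rep_iso q \<tau> (rep_sum Ws)"
      using less.IH[of a \<sigma>] less.IH[of b \<tau>] unfolding has_summand_dims_def by auto
    have VW: "list_all2 (indecomposable_rep q) (ds @ es) (Vs @ Ws)"
      using V W by (simp add: list_all2_appendI)
    have "similar_mat (diag_block_mat [\<sigma> 1, \<tau> 1]) (rep_sum (Vs @ Ws) 1)"
      unfolding rep_sum_append
      using similar_diag_mat_block_mat[of "[(\<sigma> 1, rep_sum Vs 1), (\<tau> 1, rep_sum Ws 1)]"]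
        rep_isoD[OF V(2) assms(2)] rep_isoD[OF W(2) assms(2)] by auto
    with sim have "similar_mat (\<rho> 1) (rep_sum (Vs @ Ws) 1)" by (rule similar_mat_trans)
    moreover have "\<forall>W \<in> set (Vs @ Ws). \<exists>e. cyclic_rep q e W"
      using VW by (metis indecomposable_rep_def in_set_conv_nth list_all2_conv_all_nth)
    ultimately have "rep_iso q \<rho> (rep_sum (Vs @ Ws))"
      using \<rho> assms(2) by (intro rep_isoI)
    with VW show ?thesis unfolding has_summand_dims_def by blast
  qed
qed

section \<open>Indecomposables as single unipotent Jordan blocks\<close>

lemma diag_block_mat_two_eq_one:
  assumes "A \<in> carrier_mat a a" "B \<in> carrier_mat b b" "diag_block_mat [A, B] = 1\<^sub>m (a + b)"
  shows "A = 1\<^sub>m a" "B = 1\<^sub>m b"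
proof -
  show "A = 1\<^sub>m a"
  proof (rule eq_matI)
    fix i j assume "i < dim_row (1\<^sub>m a)" "j < dim_col (1\<^sub>m a)"
    then have ij: "i < a" "j < a" by simp_all
    have "A $$ (i, j) = diag_block_mat [A, B] $$ (i, j)"
      unfolding diag_block_mat_pair using ij assms(1,2) by simp
    then show "A $$ (i, j) = 1\<^sub>m a $$ (i, j)"
      unfolding assms(3) using ij by simp
  qed (use assms in auto)
  show "B = 1\<^sub>m b"
  proof (rule eq_matI)
    fix i j assume "i < dim_row (1\<^sub>m b)" "j < dim_col (1\<^sub>m b)"
    then have ij: "i < b" "j < b" by simp_all
    have "B $$ (i, j) = diag_block_mat [A, B] $$ (a + i, a + j)"
      unfolding diag_block_mat_pair using ij assms(1,2) by simp
    then show "B $$ (i, j) = 1\<^sub>m b $$ (i, j)"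
      unfolding assms(3) using ij by simp
  qed (use assms in auto)
qed

lemma jordan_matrix_Cons:
  "jordan_matrix ((a, x) # n_as) = diag_block_mat [jordan_block a x, jordan_matrix n_as]"
  unfolding diag_block_mat_pair by (simp add: jordan_matrix_def Let_def)

lemma similar_mat_pow_eq_one:
  assumes "similar_mat A B" "A ^\<^sub>m q = 1\<^sub>m d" "A \<in> carrier_mat d d"
  shows "B ^\<^sub>m q = 1\<^sub>m d" "B \<in> carrier_mat d d"
proof -
  from assms(1) obtain P Q where "similar_mat_wit A B P Q" by (auto simp: similar_mat_def)
  then have w: "similar_mat_wit B A Q P" by (rule similar_mat_wit_sym)
  from similar_mat_witD2[OF assms(3) similar_mat_wit_sym[OF w]]
  show B: "B \<in> carrier_mat d d" by simp
  from similar_mat_witD2[OF B w] have "Q * P = 1\<^sub>m d" "P \<in> carrier_mat d d" "Q \<in> carrier_mat d d" by auto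
  then show "B ^\<^sub>m q = 1\<^sub>m d"
    using similar_mat_wit_pow_id[OF w, of q] assms(2) by simp
qed

text \<open>An eigenvalue \<open>y\<close> satisfies \<open>y^q = 1\<close>, hence
  \<open>(y - 1)^q = 0\<close> when \<open>q\<close> is a power of the characteristic.\<close>

lemma jordan_matrix_pow_CHAR_power_eq_one:
  fixes n_as :: "(nat \<times> 'k::field) list"
  assumes "prime CHAR('k)" "0 \<notin> fst ` set n_as"
    and "jordan_matrix n_as ^\<^sub>m (CHAR('k) ^ s) = 1\<^sub>m (sum_list (map fst n_as))"
    and "(a, x) \<in> set n_as"
  shows "x = 1"
  using assms(2-)
proof (induction n_as)
  case (Cons ay n_as)
  obtain c y where ay: "ay = (c, y)" by force
  let ?q = "CHAR('k) ^ s"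
  let ?m = "sum_list (map fst n_as)"
  have "diag_block_mat [jordan_block c y ^\<^sub>m ?q, jordan_matrix n_as ^\<^sub>m ?q] = 1\<^sub>m (c + ?m)"
    using Cons.prems(2) unfolding ay jordan_matrix_Cons by (subst (asm) diag_block_pow_mat) auto
  then have J: "jordan_block c y ^\<^sub>m ?q = 1\<^sub>m c" and R: "jordan_matrix n_as ^\<^sub>m ?q = 1\<^sub>m ?m"
    by (rule diag_block_mat_two_eq_one[rotated 2]; auto)+
  \<comment> \<open>Blocks have positive size, so the entry \<open>(0, 0)\<close> exists; on the
    left it is \<open>y ^ ?q\<close>.\<close>
  have "(jordan_block c y ^\<^sub>m ?q) $$ (0, 0) = 1" using J Cons.prems(1) by (simp add: ay)
  then have "y ^ ?q = 1" using Cons.prems(1) by (auto simp: ay jordan_block_pow)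
  moreover have "(1 + (y - 1)) ^ ?q = 1 ^ ?q + (y - 1) ^ ?q"
    by (rule freshmans_dream'[OF assms(1) refl])
  ultimately have "(y - 1) ^ ?q = 0" by simp
  then have "y = 1" by simp
  with Cons R show ?case by (auto simp: ay)
qed simp

text \<open>The only eigenvalue is \<open>1\<close>, and a second Jordan block would split off as a
  direct summand.\<close>

lemma indecomposable_rep_jordan_nf:
  fixes \<rho> :: "int \<Rightarrow> 'k::alg_closed_field mat"
  assumes p: "prime CHAR('k)" and q: "q = CHAR('k) ^ s" "q > 1" and \<rho>: "indecomposable_rep q d \<rho>"
  shows "jordan_nf (\<rho> 1) [(d, 1)]" "d > 0" "d \<le> q"
proof -
  from \<rho> have c: "cyclic_rep q d \<rho>" and d: "d > 0" by (auto simp: indecomposable_rep_def)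
  note gen = cyclic_rep_generator_order[OF c q(2)]
  obtain n_as where nf: "jordan_nf (\<rho> 1) n_as" using jordan_nf_exists_alg_closed[OF gen(1)] by blast
  let ?J = "jordan_matrix n_as"
  have sim: "similar_mat (\<rho> 1) ?J" and pos: "0 \<notin> fst ` set n_as" using nf by (auto simp: jordan_nf_def)
  note J = similar_mat_pow_eq_one[OF sim gen(2,1)]
  then have dsum: "d = sum_list (map fst n_as)" by auto
  have ones: "x = 1" if "(a, x) \<in> set n_as" for a x
    using jordan_matrix_pow_CHAR_power_eq_one[OF p pos _ that] J q dsum by simp
  from dsum d obtain a n_as' where n_as: "n_as = (a, 1) # n_as'"
    using ones by (cases n_as) auto
  let ?b = "sum_list (map fst n_as')"
  have Jq: "diag_block_mat [jordan_block a 1 ^\<^sub>m q, jordan_matrix n_as' ^\<^sub>m q] = 1\<^sub>m (a + ?b)"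
    using J(1) unfolding n_as jordan_matrix_Cons dsum by (subst (asm) diag_block_pow_mat) auto
  then have blocks: "jordan_block a (1::'k) ^\<^sub>m q = 1\<^sub>m a" "jordan_matrix n_as' ^\<^sub>m q = 1\<^sub>m ?b"
    by (rule diag_block_mat_two_eq_one[rotated 2]; auto)+
  have "n_as' = []"
  proof (rule ccontr)
    assume "n_as' \<noteq> []"
    then have ab: "a > 0" "?b > 0" using pos by (cases n_as'; auto simp: n_as)+
    let ?\<sigma> = "\<lambda>g. jordan_block a (1::'k) ^\<^sub>m nat g" and ?\<tau> = "\<lambda>g. jordan_matrix n_as' ^\<^sub>m nat g"
    have \<sigma>\<tau>: "cyclic_rep q a ?\<sigma>" "cyclic_rep q ?b ?\<tau>"
      using blocks q(2) by (auto intro!: cyclic_rep_powers)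
    have "jordan_block a (1::'k) ^\<^sub>m 1 = jordan_block a 1" "jordan_matrix n_as' ^\<^sub>m 1 = jordan_matrix n_as'"
      by simp_all
    then have "rep_iso q \<rho> (rep_sum [?\<sigma>, ?\<tau>])"
      using \<sigma>\<tau> c q(2) sim by (intro rep_isoI) (auto simp: rep_sum_def n_as jordan_matrix_Cons 
          simp del: diag_block_mat.simps pow_mat.simps)
    with \<rho> ab \<sigma>\<tau> show False unfolding indecomposable_rep_def by blast
  qed
  then show "jordan_nf (\<rho> 1) [(d, 1)]" "d > 0" using nf dsum d by (auto simp: n_as)
  show "d \<le> q"
  proof (rule ccontr)
    assume "\<not> d \<le> q"
    then have "q < a" using dsum \<open>n_as' = []\<close> by (simp add: n_as)
    \<comment> \<open>The entry is the binomial coefficient \<open>q choose q\<close>, while the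
      identity matrix has \<open>0\<close> there.\<close>
    then have "(jordan_block a (1::'k) ^\<^sub>m q) $$ (0, q) = 1" by (simp add: jordan_block_pow)
    with blocks(1) \<open>q < a\<close> q(2) show False by simp
  qed
qed

text \<open>The generator of a direct sum is block diagonal, so the single blocks of the summands
  together form its Jordan normal form.\<close>

lemma has_summand_dims_jordan_nf:
  fixes \<rho> :: "int \<Rightarrow> 'k::alg_closed_field mat"
  assumes p: "prime CHAR('k)" and q: "q = CHAR('k) ^ s" "q > 1"
    and "has_summand_dims q \<rho> ds"
  shows "jordan_nf (\<rho> 1) (map (\<lambda>d. (d, 1)) ds)" "\<forall>d \<in> set ds. d \<le> q"
proof -
  obtain Ws where Ws: "list_all2 (indecomposable_rep q) ds Ws" "rep_iso q \<rho> (rep_sum Ws)"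
    using assms(4) by (auto simp: has_summand_dims_def)
  note ind = indecomposable_rep_jordan_nf[OF p q]
  have "jordan_nf (diag_block_mat (map (\<lambda>W. W 1) Ws)) (map (\<lambda>d. (d, 1)) ds)"
  proof -
    let ?Ms = "map2 (\<lambda>d W. (W (1::int), [(d, 1::'k)])) ds Ws"
    have len: "length ds = length Ws" using Ws(1) by (rule list_all2_lengthD)
    have "jordan_nf (diag_block_mat (map fst ?Ms)) (concat (map snd ?Ms))"
      using Ws(1) ind(1) by (intro jordan_nf_diag_block_mat) (auto simp: list_all2_iff)
    moreover have "map fst ?Ms = map (\<lambda>W. W 1) Ws" "concat (map snd ?Ms) = map (\<lambda>d. (d, 1)) ds"
      using len by (induction ds Ws rule: list_induct2) auto
    ultimately show ?thesis by simp
  qed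
  moreover have "similar_mat (\<rho> 1) (diag_block_mat (map (\<lambda>W. W 1) Ws))"
    using rep_isoD[OF Ws(2) q(2)] by (simp add: rep_sum_def)
  ultimately show "jordan_nf (\<rho> 1) (map (\<lambda>d. (d, 1)) ds)"
    unfolding jordan_nf_def by (blast intro: similar_mat_trans)
  show "\<forall>d \<in> set ds. d \<le> q"
    using Ws(1) ind(3) by (metis in_set_conv_nth list_all2_conv_all_nth)
qed

lemma summand_dims:
  fixes \<rho> :: "int \<Rightarrow> 'k::alg_closed_field mat"
  assumes p: "prime CHAR('k)" and q: "q = CHAR('k) ^ s" "q > 1"
    and \<rho>: "cyclic_rep q d \<rho>"
  shows "jordan_nf (\<rho> 1) (map (\<lambda>d. (d, 1)) (summand_dims q \<rho>))"
    and "\<forall>d \<in> set (summand_dims q \<rho>). d \<le> q"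
proof -
  have "has_summand_dims q \<rho> (summand_dims q \<rho>)"
    unfolding summand_dims_def using has_summand_dims_exists[OF \<rho> q(2)] by (rule someI_ex)
  from has_summand_dims_jordan_nf[OF p q this]
  show "jordan_nf (\<rho> 1) (map (\<lambda>d. (d, 1)) (summand_dims q \<rho>))"
    and "\<forall>d \<in> set (summand_dims q \<rho>). d \<le> q" by blast+
qed

section \<open>Restriction to a subgroup\<close>

lemma cyclic_rep_restrict:
  assumes \<rho>: "cyclic_rep (m * q) d \<rho>" and m: "m > 0" and q: "q > 1"
  shows "cyclic_rep q d (restrict_rep m \<rho>)"
proof -
  have "m * q > 1" using m q by (simp add: less_1_mult le_neq_implies_less)
  then have c: "\<rho> (int m * x) \<in> carrier (units_of (ring_mat TYPE('a) d ()))" if "0 \<le> x" "x < int q" for x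
    using \<rho> that m q
    by (auto simp: cyclic_rep_def hom_def Pi_def carrier_integer_mod_group)
  have "\<rho> (int m * ((x + y) mod int q)) = \<rho> (int m * x) \<otimes>\<^bsub>units_of (ring_mat TYPE('a) d ())\<^esub> \<rho> (int m * y)"
    if "0 \<le> x" "x < int q" "0 \<le> y" "y < int q" for x y
  proof -
    \<comment> \<open>Multiplication by \<open>m\<close> is compatible with addition modulo
      \<open>q\<close> and modulo \<open>m * q\<close>: it sends residues to residues.\<close>
    have "int m * ((x + y) mod int q) = (int m * x + int m * y) mod int (m * q)"
      by (simp add: mult_mod_right distrib_left)
    then show ?thesis
      using \<rho> that m q by (auto simp: cyclic_rep_def hom_def carrier_integer_mod_group)
  qed
  with c show ?thesis
    using q by (auto simp: cyclic_rep_def hom_def restrict_rep_def carrier_integer_mod_group)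
qed

text \<open>
  Both sides are the dimension of the kernel of \<open>(\<rho> 1 - 1)\<^bsup>p^r k\<^esup> = (\<rho> (p^r) - 1)\<^bsup>k\<^esup>\<close>.  This replaces
  the explicit decomposition of the restricted representation, and the Krull-Schmidt theorem.
\<close>

lemma summand_dims_restrict_min:
  fixes \<rho> :: "int \<Rightarrow> 'k::alg_closed_field mat"
  assumes p: "prime CHAR('k)" and r: "r < n" and \<rho>: "cyclic_rep (CHAR('k) ^ n) d \<rho>"
  shows "(\<Sum>e \<leftarrow> summand_dims (CHAR('k) ^ (n - r)) (restrict_rep (CHAR('k) ^ r) \<rho>). min k e)
       = (\<Sum>e \<leftarrow> summand_dims (CHAR('k) ^ n) \<rho>. min (CHAR('k) ^ r * k) e)"
proof -
  let ?p = "CHAR('k)"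
  let ?\<sigma> = "restrict_rep (?p ^ r) \<rho>"
  have gt1: "?p ^ s > 1" if "s > 0" for s
    using that prime_gt_1_nat[OF p] one_less_power by blast
  have pn: "?p ^ n = ?p ^ r * ?p ^ (n - r)" using r by (simp flip: power_add)
  have \<sigma>: "cyclic_rep (?p ^ (n - r)) d ?\<sigma>"
    using \<rho> r gt1 p prime_gt_0_nat[OF p] unfolding pn by (intro cyclic_rep_restrict) auto
  have gen: "\<rho> 1 \<in> carrier_mat d d"
    using \<rho> r gt1 by (intro cyclic_rep_generator_order(1)) auto
  \<comment> \<open>As \<open>r < n\<close>, the number \<open>p ^ r\<close> is its own residue
    modulo \<open>p ^ n\<close>; it is the element to which restriction sends the generator
    \<open>1\<close>.\<close>
  have "?p ^ r < ?p ^ n" using r prime_gt_1_nat[OF p] by (intro power_strict_increasing)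
  then have s1: "?\<sigma> 1 = \<rho> 1 ^\<^sub>m (?p ^ r)"
    using cyclic_rep_power[OF \<rho>, of "?p ^ r"] gt1[of n] r 
    by (simp add: restrict_rep_def mod_pos_pos_trivial flip: of_nat_power)
  \<comment> \<open>On a unipotent block of size \<open>e\<close>, the kernel of
    \<open>(A - 1)^k\<close> has dimension \<open>min k e\<close>.\<close>
  have ev: "dim_gen_eigenspace A 1 k = (\<Sum>e \<leftarrow> ds. min k e)"
    if "jordan_nf A (map (\<lambda>d. (d, 1)) ds)" for A :: "'k mat" and ds k
    using dim_gen_eigenspace[OF that, of 1 k] by (simp add: filter_map o_def)
  have "(\<Sum>e \<leftarrow> summand_dims (?p ^ (n - r)) ?\<sigma>. min k e) = dim_gen_eigenspace (?\<sigma> 1) 1 k"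
    using summand_dims(1)[OF p refl _ \<sigma>] r gt1 by (simp add: ev)
  also have "\<dots> = dim_gen_eigenspace (\<rho> 1) 1 (?p ^ r * k)"
    using gen by (simp add: dim_gen_eigenspace_def s1 char_matrix_pow_CHAR_power[OF gen p]
        pow_mat_mult[of _ d])
  also have "\<dots> = (\<Sum>e \<leftarrow> summand_dims (?p ^ n) \<rho>. min (?p ^ r * k) e)"
    using summand_dims(1)[OF p refl _ \<rho>] r gt1 by (simp add: ev)
  finally show ?thesis .
qed

section \<open>Restriction of the invariants\<close>

lemma sum_list_sum_swap:
  "(\<Sum>x\<leftarrow>xs. \<Sum>k\<in>A. f x k) = (\<Sum>k\<in>A. \<Sum>x\<leftarrow>xs. (f x k :: 'a::comm_monoid_add))"
  by (induction xs) (auto simp: sum.distrib)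

section \<open>Digit expansions in base \<open>p\<close>\<close>

lemma sum_digits_eq_mod:
  fixes p :: nat
  shows "(\<Sum>k<n. (x div p ^ k mod p) * p ^ k) = x mod p ^ n"
  by (induction n) (auto simp: mod_mult2_eq power_Suc2 simp del: power_Suc)

lemma digit_sum_less:
  fixes p :: nat
  assumes "\<And>k. k < n \<Longrightarrow> i k < p"
  shows "(\<Sum>k<n. i k * p ^ k) < p ^ n"
  using assms
proof (induction n)
  case (Suc n)
  have "(\<Sum>k<Suc n. i k * p ^ k) < p ^ n + i n * p ^ n" using Suc by simp
  also have "\<dots> = Suc (i n) * p ^ n" by simp
  also have "\<dots> \<le> p * p ^ n" using Suc.prems[of n] by (intro mult_right_mono) auto
  finally show ?case by simp
qed simp

text \<open>After division by \<open>p ^ m\<close>, the digits above \<open>m\<close> contribute a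
  multiple of \<open>p\<close> and those below contribute nothing.\<close>

lemma digit_of_digit_sum:
  fixes p :: nat
  assumes "\<And>k. k < n \<Longrightarrow> i k < p" "m < n"
  shows "(\<Sum>k<n. i k * p ^ k) div p ^ m mod p = i m"
  using assms
proof (induction n)
  case (Suc n)
  let ?s = "\<Sum>k<n. i k * p ^ k"
  have p: "p > 0" using Suc.prems(1)[of n] by simp
  show ?case
  proof (cases "m = n")
    case True
    have "?s < p ^ n" using Suc.prems by (intro digit_sum_less) simp
    then show ?thesis using Suc.prems p True by simp
  next
    case False
    then have m: "m < n" using Suc.prems by simp
    then have "n = m + Suc (n - m - 1)" by simp
    then have "p ^ n = p ^ m * (p * p ^ (n - m - 1))"
      by (metis power_add power_Suc)
    then have "(\<Sum>k<Suc n. i k * p ^ k) = ?s + p ^ m * (p * (i n * p ^ (n - m - 1)))"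
      by simp
    then have "(\<Sum>k<Suc n. i k * p ^ k) div p ^ m = ?s div p ^ m + p * (i n * p ^ (n - m - 1))"
      using p by (simp only: div_mult_self2) simp
    then show ?thesis using Suc m by simp
  qed
qed simp

text \<open>Digit vectors correspond to the numbers below \<open>p ^ n\<close>, and
  \<open>d \<le> p ^ n\<close> ensures that every \<open>x < d\<close> occurs. In this form the
  effect of replacing \<open>x\<close> by \<open>x div p ^ r\<close> becomes visible.\<close>

lemma S_inv_eq_sum_digits:
  assumes p: "p > 0" and d: "d \<le> p ^ n" and m: "m < n"
  shows "S_inv p n d m = (\<Sum>x<d. x div p ^ m mod p)"
  unfolding S_inv_def
proof (rule sum.reindex_bij_witness[where
      i = "\<lambda>x. \<lambda>k\<in>{..<n}. x div p ^ k mod p" and j = "\<lambda>i. \<Sum>k<n. i k * p ^ k"])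
  fix i assume "i \<in> digit_vectors p n d"
  then have i: "i \<in> {..<n} \<rightarrow>\<^sub>E {..<p}" "(\<Sum>k<n. i k * p ^ k) < d" by (auto simp: digit_vectors_def)
  then have *: "(\<Sum>k<n. i k * p ^ k) div p ^ k mod p = i k" if "k < n" for k
    using that by (intro digit_of_digit_sum) auto
  show "(\<lambda>k\<in>{..<n}. (\<Sum>k<n. i k * p ^ k) div p ^ k mod p) = i"
    using i * by (intro ext) (auto simp: restrict_def PiE_def extensional_def)
  show "(\<Sum>k<n. i k * p ^ k) \<in> {..<d}" using i by simp
  show "(\<Sum>k<n. i k * p ^ k) div p ^ m mod p = i m" using * m .
next
  fix x assume "x \<in> {..<d}"
  then have "x < d" "x < p ^ n" using d by auto
  then have "(\<Sum>k<n. (\<lambda>k\<in>{..<n}. x div p ^ k mod p) k * p ^ k) = x"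
    using sum_digits_eq_mod[where p = p and x = x and n = n] by simp
  then show "(\<Sum>k<n. (\<lambda>k\<in>{..<n}. x div p ^ k mod p) k * p ^ k) = x"
    "(\<lambda>k\<in>{..<n}. x div p ^ k mod p) \<in> digit_vectors p n d"
    using p \<open>x < d\<close> by (auto simp: digit_vectors_def)
qed

text \<open>The factor in parentheses counts the \<open>x < d\<close> with \<open>x div q = k\<close>.\<close>

lemma sum_div_by_levels:
  fixes g :: "nat \<Rightarrow> real"
  assumes q: "q > 0" and "d \<le> q * K"
  shows "(\<Sum>x<d. g (x div q)) = (\<Sum>k<K. (real (min (q * Suc k) d) - real (min (q * k) d)) * g k)"
  using assms(2)
proof (induction d)
  case (Suc d)
  let ?k = "d div q"
  have k: "q * ?k \<le> d" "d < q * Suc ?k" "?k < K"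
    using q Suc.prems by (auto simp: div_less_iff_less_mult mult.commute dividend_less_times_div)
  \<comment> \<open>Passing from \<open>d\<close> to \<open>Suc d\<close> adds one number at level
    \<open>d div q\<close> and leaves all other levels unchanged.\<close>
  have step: "real (min (q * Suc k) (Suc d)) - real (min (q * k) (Suc d))
      = real (min (q * Suc k) d) - real (min (q * k) d) + (if k = ?k then 1 else 0)" for k
  proof -
    consider "k < ?k" | "k = ?k" | "k > ?k" by linarith
    then show ?thesis
    proof cases
      case 1
      then have "q * Suc k \<le> q * ?k" "q * k \<le> q * ?k" by (intro mult_le_mono; simp)+
      then have "q * Suc k \<le> d" "q * k \<le> d" using k by linarith+
      then show ?thesis using 1 by (simp add: min_absorb1)
    next
      case 2
      then have "Suc d \<le> q * Suc k" "d \<le> q * Suc k" "q * k \<le> d" "q * k \<le> Suc d"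
        using k unfolding 2 by linarith+
      then have "min (q * Suc k) (Suc d) = Suc d" "min (q * Suc k) d = d"
        "min (q * k) d = q * k" "min (q * k) (Suc d) = q * k"
        by (simp_all only: min_absorb1 min_absorb2)
      then show ?thesis using 2 by (simp only:) simp
    next
      case 3
      then have "q * Suc ?k \<le> q * k" "q * Suc ?k \<le> q * Suc k" by (intro mult_le_mono; simp)+
      then show ?thesis using 3 k by (simp add: min_def)
    qed
  qed
  have "(\<Sum>x<Suc d. g (x div q)) = (\<Sum>k<K. (real (min (q * Suc k) d) - real (min (q * k) d)) * g k)
      + (\<Sum>k<K. (if k = ?k then 1 else 0) * g k)"
    using Suc k by (simp add: if_distrib[of "\<lambda>x. x * _"] cong: if_cong)
  also have "\<dots> = (\<Sum>k<K. (real (min (q * Suc k) (Suc d)) - real (min (q * k) (Suc d))) * g k)"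
    unfolding step by (simp only: distrib_right sum.distrib)
  finally show ?case .
qed simp

text \<open>Differences of the sums of minima count the indices at each level, so both sides reduce
  to one sum over levels. The \<open>m\<close>-th digit of \<open>x div p ^ r\<close> is the digit
  \<open>m + r\<close> of \<open>x\<close>.\<close>

lemma sum_list_S_inv_restrict:
  assumes p: "p > 0" and r: "r < n" and m: "m < n - r"
    and ds: "\<forall>d \<in> set ds. d \<le> p ^ n" and es: "\<forall>e \<in> set es. e \<le> p ^ (n - r)"
    and eq: "\<And>k. (\<Sum>e\<leftarrow>es. min k e) = (\<Sum>d\<leftarrow>ds. min (p ^ r * k) d)"
  shows "(\<Sum>e\<leftarrow>es. real (S_inv p (n - r) e m)) = (\<Sum>d\<leftarrow>ds. real (S_inv p n d (m + r)))"
proof -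
  define K where "K = p ^ (n - r)"
  define g where "g x = real (x div p ^ m mod p)" for x
  have pn: "p ^ n = p ^ r * K" using r by (simp add: K_def flip: power_add)
  \<comment> \<open>Writing \<open>x\<close> as \<open>x div 1\<close> treats both sides alike, with
    levels of width \<open>1\<close> and \<open>p ^ r\<close>.\<close>
  have "(\<Sum>e\<leftarrow>es. real (S_inv p (n - r) e m)) = (\<Sum>e\<leftarrow>es. \<Sum>x<e. g (x div 1))"
    using es m p by (intro arg_cong[where f = sum_list] map_cong refl)
      (simp add: S_inv_eq_sum_digits g_def)
  also have "\<dots> = (\<Sum>e\<leftarrow>es. \<Sum>k<K. (real (min (1 * Suc k) e) - real (min (1 * k) e)) * g k)"
    using es by (intro arg_cong[where f = sum_list] map_cong refl sum_div_by_levels) (simp_all add: K_def)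
  also have "\<dots> = (\<Sum>k<K. (real (\<Sum>e\<leftarrow>es. min (Suc k) e) - real (\<Sum>e\<leftarrow>es. min k e)) * g k)"
    by (simp add: sum_list_sum_swap sum_list_mult_const sum_list_subtractf o_def flip: sum_list_of_nat)
  also have "\<dots> = (\<Sum>d\<leftarrow>ds. \<Sum>k<K. (real (min (p ^ r * Suc k) d) - real (min (p ^ r * k) d)) * g k)"
    unfolding eq by (simp add: sum_list_sum_swap sum_list_mult_const sum_list_subtractf o_def flip: sum_list_of_nat)
  also have "\<dots> = (\<Sum>d\<leftarrow>ds. \<Sum>x<d. g (x div p ^ r))"
    using ds p by (intro arg_cong[where f = sum_list] map_cong refl sum_div_by_levels[symmetric])
      (simp_all add: pn)
  also have "\<dots> = (\<Sum>d\<leftarrow>ds. real (S_inv p n d (m + r)))"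
    using ds m p by (intro arg_cong[where f = sum_list] map_cong refl)
      (simp add: S_inv_eq_sum_digits g_def div_mult2_eq power_add mult.commute[of "p ^ m" "p ^ r"])
  finally show ?thesis .
qed

section \<open>Restriction of \<open>D\<close> and of the inequalities\<close>

lemma sum_list_D_indec:
  "(\<Sum>d\<leftarrow>ds. D_indec p n d m) = real p ^ (n - 1) * ((\<Sum>d\<leftarrow>ds. real (S_inv p n d m)) -
     (real p - 1) * (\<Sum>l = m + 1..<n. real p powi (int m - int l) * (\<Sum>d\<leftarrow>ds. real (S_inv p n d l))))"
  unfolding D_indec_def
  by (simp add: sum_list_const_mult sum_list_subtractf sum_list_sum_swap)

text \<open>The inner powers of \<open>p\<close> depend only on differences of indices and survive
  the shift by \<open>r\<close>. The outer factors \<open>p ^ (n - 1)\<close> and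
  \<open>p ^ (n - r - 1)\<close> account for the division by \<open>p ^ r\<close>.\<close>

lemma sum_list_D_indec_restrict:
  assumes p: "p > 0" and r: "r < n" and m: "m < n - r"
    and ds: "\<forall>d \<in> set ds. d \<le> p ^ n" and es: "\<forall>e \<in> set es. e \<le> p ^ (n - r)"
    and eq: "\<And>k. (\<Sum>e\<leftarrow>es. min k e) = (\<Sum>d\<leftarrow>ds. min (p ^ r * k) d)"
  shows "(\<Sum>e\<leftarrow>es. D_indec p (n - r) e m) = (\<Sum>d\<leftarrow>ds. D_indec p n d (m + r)) / real p ^ r"
proof -
  note S = sum_list_S_inv_restrict[OF p r _ ds es eq]
  have "{m + r + 1..<n} = {(m + 1) + r..<(n - r) + r}" using r by auto
  then have "(\<Sum>l = m + r + 1..<n. real p powi (int (m + r) - int l) * (\<Sum>d\<leftarrow>ds. real (S_inv p n d l)))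
      = (\<Sum>l = m + 1..<n - r. real p powi (int m - int l) * (\<Sum>d\<leftarrow>ds. real (S_inv p n d (l + r))))"
    by (simp only: sum.shift_bounds_nat_ivl) simp
  also have "\<dots> = (\<Sum>l = m + 1..<n - r. real p powi (int m - int l) * (\<Sum>e\<leftarrow>es. real (S_inv p (n - r) e l)))"
    by (intro sum.cong refl) (simp add: S)
  finally have *: "(\<Sum>d\<leftarrow>ds. D_indec p n d (m + r)) = real p ^ (n - 1) * ((\<Sum>e\<leftarrow>es. real (S_inv p (n - r) e m)) -
     (real p - 1) * (\<Sum>l = m + 1..<n - r. real p powi (int m - int l) * (\<Sum>e\<leftarrow>es. real (S_inv p (n - r) e l))))"
    unfolding sum_list_D_indec by (simp add: S m)
  have "real p ^ (n - 1) = real p ^ (n - r - 1) * real p ^ r"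
    using r by (simp flip: power_add)
  then show ?thesis using p unfolding * by (subst sum_list_D_indec) simp
qed

text \<open>The exponent \<open>2 * n - 1 - (l + r)\<close> exceeds
  \<open>2 * (n - r) - 1 - l\<close> by \<open>r\<close>, which absorbs the factor
  \<open>p ^ r\<close> between \<open>D'\<close> and \<open>D\<close>.\<close>

lemma margin_restrict:
  assumes p: "p > 0" and r: "r < n" and m: "m < n - r"
    and D: "\<And>l. l < n - r \<Longrightarrow> D' l = D (l + r) / real p ^ r"
  shows "1 - 1 / real p ^ (n - r - m) - (\<Sum>l = m..<n - r. D' l / real p ^ (2 * (n - r) - 1 - l))
       = 1 - 1 / real p ^ (n - (m + r)) - (\<Sum>l = m + r..<n. D l / real p ^ (2 * n - 1 - l))"
proof -
  have "{m + r..<n} = {m + r..<(n - r) + r}" using r by auto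
  then have "(\<Sum>l = m + r..<n. D l / real p ^ (2 * n - 1 - l))
     = (\<Sum>l = m..<n - r. D (l + r) / real p ^ (2 * n - 1 - (l + r)))"
    by (simp only: sum.shift_bounds_nat_ivl)
  also have "\<dots> = (\<Sum>l = m..<n - r. D' l / real p ^ (2 * (n - r) - 1 - l))"
  proof (intro sum.cong refl)
    fix l assume l: "l \<in> {m..<n - r}"
    then have "2 * n - 1 - (l + r) = r + (2 * (n - r) - 1 - l)" using r by auto
    then have "real p ^ (2 * n - 1 - (l + r)) = real p ^ r * real p ^ (2 * (n - r) - 1 - l)"
      by (simp only: power_add)
    then show "D (l + r) / real p ^ (2 * n - 1 - (l + r)) = D' l / real p ^ (2 * (n - r) - 1 - l)"
      using D[of l] l by simp
  qed
  finally show ?thesis by (simp add: add.commute)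
qed

section \<open>Jumps and stratum dimensions\<close>

text \<open>Summation by parts: for \<open>m < k\<close>, the upper jump at \<open>m\<close> occurs
  with coefficient \<open>p ^ m - p ^ (m + 1)\<close>.\<close>

lemma real_lower_jump:
  "real_of_int (lower_jump p j k) = real p ^ k * upper_jump p j k
     - (real p - 1) * (\<Sum>m<k. real p ^ m * upper_jump p j m)"
  by (induction k) (auto simp: lower_jump_def algebra_simps)

text \<open>Rewrites a combination of the lower jumps as a combination of the upper jumps: the
  coefficients on the right are those in the definition of \<^const>\<open>D_indec\<close>.\<close>

lemma sum_jumps_exchange:
  fixes S u :: "nat \<Rightarrow> real"
  assumes "p > 0"
  shows "(\<Sum>k<n. S k / p ^ Suc k * (p ^ k * u k - (p - 1) * (\<Sum>m<k. p ^ m * u m)))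
     = (\<Sum>m<n. u m * (S m - (p - 1) * (\<Sum>l = m + 1..<n. p ^ m / p ^ l * S l)) / p)"
proof (induction n)
  case (Suc n)
  have "u m * (S m - (p - 1) * (\<Sum>l = m + 1..<Suc n. p ^ m / p ^ l * S l)) / p
     = u m * (S m - (p - 1) * (\<Sum>l = m + 1..<n. p ^ m / p ^ l * S l)) / p
          - (p - 1) * (p ^ m * u m) * (S n / p ^ Suc n)" if "m < n" for m
  proof -
    have "u m * (S m - (p - 1) * (X + p ^ m / p ^ n * S n)) / p
       = u m * (S m - (p - 1) * X) / p - (p - 1) * (p ^ m * u m) * (S n / p ^ Suc n)" for X
      using assms by (simp add: field_simps)
    then show ?thesis using that by simp
  qed
  then have "(\<Sum>m<Suc n. u m * (S m - (p - 1) * (\<Sum>l = m + 1..<Suc n. p ^ m / p ^ l * S l)) / p)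
     = (\<Sum>m<n. u m * (S m - (p - 1) * (\<Sum>l = m + 1..<n. p ^ m / p ^ l * S l)) / p
          - (p - 1) * (p ^ m * u m) * (S n / p ^ Suc n)) + u n * S n / p"
    by simp
  also have "\<dots> = (\<Sum>m<n. u m * (S m - (p - 1) * (\<Sum>l = m + 1..<n. p ^ m / p ^ l * S l)) / p)
     + S n / p ^ Suc n * (p ^ n * u n - (p - 1) * (\<Sum>m<n. p ^ m * u m))"
  proof -
    have "(\<Sum>m<n. (p - 1) * (p ^ m * u m) * (S n / p ^ Suc n)) = S n / p ^ Suc n * ((p - 1) * (\<Sum>m<n. p ^ m * u m))"
      by (simp only: sum_distrib_left mult_ac)
    moreover have "u n * S n / p = S n / p ^ Suc n * (p ^ n * u n)" using assms by simp
    ultimately show ?thesis by (simp only: sum_subtractf right_diff_distrib)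
  qed
  finally show ?case using Suc by simp
qed simp

text \<open>The left-hand side is the \<open>v\<close>-function before rounding. Summing over digit
  vectors first produces \<open>S_inv\<close>; exchanging lower for upper jumps then produces
  \<open>D_indec\<close>.\<close>

lemma v_indec_main_term:
  assumes p: "p > 0" and n: "n \<ge> 1"
  shows "(\<Sum>i \<in> digit_vectors p n d.
        real_of_int (\<Sum>k<n. int (i k) * int p ^ (n - 1 - k) * lower_jump p j k) / real p ^ n)
     = (\<Sum>m<n. real_of_int (upper_jump p j m) * D_indec p n d m / real p ^ n)"
proof -
  have pow: "real p ^ (n - 1 - k) / real p ^ n = 1 / real p ^ Suc k" if "k < n" for k
  proof -
    have "n = (n - 1 - k) + Suc k" using that by simp
    then have "real p ^ n = real p ^ (n - 1 - k) * real p ^ Suc k" by (metis power_add)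
    then show ?thesis using p by simp
  qed
  have "(\<Sum>i \<in> digit_vectors p n d.
        real_of_int (\<Sum>k<n. int (i k) * int p ^ (n - 1 - k) * lower_jump p j k) / real p ^ n)
     = (\<Sum>i \<in> digit_vectors p n d. \<Sum>k<n. real (i k) * (real p ^ (n - 1 - k) / real p ^ n * lower_jump p j k))"
    by (intro sum.cong refl) (simp add: sum_divide_distrib mult_ac)
  also have "\<dots> = (\<Sum>k<n. real (S_inv p n d k) * (real p ^ (n - 1 - k) / real p ^ n * lower_jump p j k))"
    by (subst sum.swap) (simp only: S_inv_def of_nat_sum sum_distrib_right)
  also have "\<dots> = (\<Sum>k<n. real (S_inv p n d k) / real p ^ Suc k * lower_jump p j k)"
    by (intro sum.cong refl, subst pow) auto
  also have "\<dots> = (\<Sum>m<n. real_of_int (upper_jump p j m) * (real (S_inv p n d m) - (real p - 1) *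
      (\<Sum>l = m + 1..<n. real p ^ m / real p ^ l * real (S_inv p n d l))) / real p)"
    unfolding real_lower_jump using p by (intro sum_jumps_exchange) simp
  also have "\<dots> = (\<Sum>m<n. real_of_int (upper_jump p j m) * D_indec p n d m / real p ^ n)"
  proof -
    have "real p powi (int m - int l) = real p ^ m / real p ^ l" for m l
      using p by (simp add: power_int_diff)
    moreover have "real p ^ n = real p * real p ^ (n - 1)" using n by (simp flip: power_Suc)
    ultimately show ?thesis using p by (intro sum.cong refl) (simp add: D_indec_def)
  qed
  finally show ?thesis .
qed

text \<open>Each ceiling adds at most \<open>1\<close>, so the error is bounded by the number of
  digit vectors, independently of \<open>j\<close>.\<close>

lemma v_indec_bounds:
  assumes p: "p > 0" and n: "n \<ge> 1"
  shows "(\<Sum>m<n. real_of_int (upper_jump p j m) * D_indec p n d m / real p ^ n) \<le> v_indec p n d j"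
    and "v_indec p n d j \<le> (\<Sum>m<n. real_of_int (upper_jump p j m) * D_indec p n d m / real p ^ n)
       + card (digit_vectors p n d)"
proof -
  define y where "y i = real_of_int (\<Sum>k<n. int (i k) * int p ^ (n - 1 - k) * lower_jump p j k) / real p ^ n" for i
  have v: "real_of_int (v_indec p n d j) = (\<Sum>i \<in> digit_vectors p n d. real_of_int \<lceil>y i\<rceil>)"
    by (simp add: v_indec_def y_def)
  have main: "(\<Sum>m<n. real_of_int (upper_jump p j m) * D_indec p n d m / real p ^ n)
      = (\<Sum>i \<in> digit_vectors p n d. y i)"
    unfolding y_def using v_indec_main_term[OF p n, where d = d and j = j] by simp
  show "(\<Sum>m<n. real_of_int (upper_jump p j m) * D_indec p n d m / real p ^ n) \<le> v_indec p n d j"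
    unfolding main v by (intro sum_mono) simp
  have "(\<Sum>i \<in> digit_vectors p n d. real_of_int \<lceil>y i\<rceil>) \<le> (\<Sum>i \<in> digit_vectors p n d. y i + 1)"
    by (intro sum_mono) linarith
  then show "v_indec p n d j \<le> (\<Sum>m<n. real_of_int (upper_jump p j m) * D_indec p n d m / real p ^ n)
       + card (digit_vectors p n d)"
    unfolding main v by (simp add: sum.distrib)
qed

lemma sum_list_v_indec_bounds:
  assumes p: "p > 0" and n: "n \<ge> 1"
  shows "(\<Sum>m<n. real_of_int (upper_jump p j m) * (\<Sum>d\<leftarrow>ds. D_indec p n d m) / real p ^ n)
       \<le> real_of_int (\<Sum>d\<leftarrow>ds. v_indec p n d j)"
    and "real_of_int (\<Sum>d\<leftarrow>ds. v_indec p n d j)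
       \<le> (\<Sum>m<n. real_of_int (upper_jump p j m) * (\<Sum>d\<leftarrow>ds. D_indec p n d m) / real p ^ n)
         + (\<Sum>d\<leftarrow>ds. real (card (digit_vectors p n d)))"
proof -
  show "(\<Sum>m<n. real_of_int (upper_jump p j m) * (\<Sum>d\<leftarrow>ds. D_indec p n d m) / real p ^ n)
       \<le> real_of_int (\<Sum>d\<leftarrow>ds. v_indec p n d j)"
  proof (induction ds)
    case (Cons d ds)
    then show ?case using v_indec_bounds(1)[OF p n, where d = d and j = j]
      by (simp add: distrib_left add_divide_distrib sum.distrib)
  qed simp
  show "real_of_int (\<Sum>d\<leftarrow>ds. v_indec p n d j)
       \<le> (\<Sum>m<n. real_of_int (upper_jump p j m) * (\<Sum>d\<leftarrow>ds. D_indec p n d m) / real p ^ n)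
         + (\<Sum>d\<leftarrow>ds. real (card (digit_vectors p n d)))"
  proof (induction ds)
    case (Cons d ds)
    then show ?case using v_indec_bounds(2)[OF p n, where d = d and j = j]
      by (simp add: distrib_left add_divide_distrib sum.distrib)
  qed simp
qed

text \<open>The coefficient of the increment \<open>u\<^sub>m - q u\<^bsub>m-1\<^esub>\<close> in \<open>\<Sum>\<^sub>l c\<^sub>l u\<^sub>l\<close>.\<close>

definition tail_weight :: "real \<Rightarrow> nat \<Rightarrow> (nat \<Rightarrow> real) \<Rightarrow> nat \<Rightarrow> real" where
  "tail_weight q n c m = (\<Sum>l = m..<n. q ^ (l - m) * c l)"

lemma tail_weight_rec: "m < n \<Longrightarrow> tail_weight q n c m = c m + q * tail_weight q n c (Suc m)"
proof -
  assume "m < n"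
  moreover have "q ^ (l - m) = q * q ^ (l - Suc m)" if "l \<in> {Suc m..<n}" for l
    using that by (simp flip: power_Suc add: Suc_diff_Suc)
  ultimately show ?thesis
    by (simp add: tail_weight_def sum.atLeast_Suc_lessThan sum_distrib_left mult.assoc)
qed

text \<open>Each \<open>u l\<close> is the sum of \<open>q ^ (l - m)\<close> times the increment at
  \<open>m\<close> over all \<open>m \<le> l\<close>; collecting the coefficients of one increment
  gives its tail weight.\<close>

lemma tail_weight_summation:
  assumes "n \<ge> 1"
  shows "(\<Sum>m<n. c m * u m) = (\<Sum>m<n. tail_weight q n c m * (if m = 0 then u 0 else u m - q * u (m - 1)))"
proof -
  \<comment> \<open>Truncation after \<open>k\<close> leaves a boundary term. At
    \<open>k = n - 1\<close> it vanishes, since the tail weight at \<open>n\<close> is an empty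
    sum.\<close>
  have "(\<Sum>m<Suc k. c m * u m) =
      (\<Sum>m<Suc k. tail_weight q n c m * (if m = 0 then u 0 else u m - q * u (m - 1)))
        - q * tail_weight q n c (Suc k) * u k" if "k < n" for k
    using that
  proof (induction k)
    case 0
    then show ?case using tail_weight_rec[of 0 n q c] by (simp add: algebra_simps)
  next
    case (Suc k)
    then show ?case using tail_weight_rec[of "Suc k" n q c] by (simp add: algebra_simps)
  qed
  from this[of "n - 1"] assms show ?thesis by (simp add: tail_weight_def)
qed

text \<open>The constant part of the weights is a geometric series. The factor in front is positive,
  so the weight has the sign of the left-hand side of the \<open>m\<close>-th inequality.\<close>

lemma tail_weight_margin:
  assumes p: "p > 0" and m: "m < n"
  shows "tail_weight (real p) n (\<lambda>l. 1 - 1 / real p - D l / real p ^ n) m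
     = real p ^ (n - m) / real p *
        (1 - 1 / real p ^ (n - m) - (\<Sum>l = m..<n. D l / real p ^ (2 * n - 1 - l)))"
proof -
  have geo: "(\<Sum>l = m..<m + N. real p ^ (l - m) * (1 - 1 / real p)) = real p ^ N / real p - 1 / real p" for N
    using p by (induction N) (auto simp: field_simps)
  have D: "real p ^ (l - m) * (D l / real p ^ n) = real p ^ (n - m) / real p * (D l / real p ^ (2 * n - 1 - l))"
    if "l \<in> {m..<n}" for l
  proof -
    have "n - m + n = (l - m) + 1 + (2 * n - 1 - l)" using that by auto
    then have "real p ^ (n - m) * real p ^ n = real p ^ (l - m) * real p * real p ^ (2 * n - 1 - l)"
      by (metis power_add power_one_right)
    then show ?thesis using p by (simp add: field_simps)
  qed
  have "tail_weight (real p) n (\<lambda>l. 1 - 1 / real p - D l / real p ^ n) m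
      = (\<Sum>l = m..<n. real p ^ (l - m) * (1 - 1 / real p)) - (\<Sum>l = m..<n. real p ^ (l - m) * (D l / real p ^ n))"
    by (simp add: tail_weight_def sum_subtractf right_diff_distrib)
  also have "(\<Sum>l = m..<n. real p ^ (l - m) * (1 - 1 / real p)) = real p ^ (n - m) / real p - 1 / real p"
    using geo[of "n - m"] m by simp
  also have "(\<Sum>l = m..<n. real p ^ (l - m) * (D l / real p ^ n))
      = real p ^ (n - m) / real p * (\<Sum>l = m..<n. D l / real p ^ (2 * n - 1 - l))"
    unfolding sum_distrib_left by (intro sum.cong refl D)
  also have "x / real p - 1 / real p - x / real p * Y = x / real p * (1 - 1 / x - Y)" if "x \<noteq> 0" for x Y
    using that p by (simp add: field_simps)
  finally show ?thesis using p by simp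
qed

text \<open>As \<open>j ! 0\<close> is not \<open>None\<close>, the index \<open>0\<close>
  contributes to every maximum, so none is taken over the empty set. A maximizer for
  \<open>i\<close>, multiplied by \<open>p\<close>, competes in the maximum for
  \<open>Suc i\<close>.\<close>

lemma upper_jump_props:
  assumes j0: "j ! 0 \<noteq> None"
  shows "upper_jump p j i \<ge> 0" "j ! i = Some a \<Longrightarrow> int a \<le> upper_jump p j i"
    "int p * upper_jump p j i \<le> upper_jump p j (Suc i)"
proof -
  let ?A = "\<lambda>i. {int (p ^ (i - m) * a) | m a. m \<le> i \<and> j ! m = Some a}"
  have fin: "finite (?A i)" for i
    by (rule finite_subset[of _ "(\<lambda>m. int (p ^ (i - m) * the (j ! m))) ` {..i}"]) force+
  obtain a0 where a0: "j ! 0 = Some a0" using j0 by blast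
  have ne: "int (p ^ i * a0) \<in> ?A i" for i
    using a0 by (intro CollectI exI[of _ 0] exI[of _ a0]) simp
  have "int (p ^ i * a0) \<le> upper_jump p j i"
    unfolding upper_jump_def using fin ne by (intro Max_ge)
  then show "upper_jump p j i \<ge> 0" by (rule order_trans[rotated]) simp
  show "int a \<le> upper_jump p j i" if "j ! i = Some a"
    unfolding upper_jump_def using that fin
    by (intro Max_ge CollectI exI[of _ i] exI[of _ a]) simp_all
  have "upper_jump p j i \<in> ?A i"
    unfolding upper_jump_def using fin ne by (intro Max_in) blast+
  then obtain m a where "m \<le> i" "j ! m = Some a" "upper_jump p j i = int (p ^ (i - m) * a)" by auto
  then show "int p * upper_jump p j i \<le> upper_jump p j (Suc i)"
    unfolding upper_jump_def[of p j "Suc i"] using fin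
    by (intro Max_ge CollectI exI[of _ m] exI[of _ a]) (simp_all add: Suc_diff_le)
qed

section \<open>Dimensions of strata\<close>

lemma stratum_dim_nth:
  "real (stratum_dim p j) = (\<Sum>m<length j. case j ! m of None \<Rightarrow> 0 | Some a \<Rightarrow> real (1 + (a - 1 - a div p)))"
  unfolding stratum_dim_def
  by (simp add: sum_list_sum_nth lessThan_atLeast0) (intro sum.cong refl; simp split: option.split)

lemma stratum_term_bounds:
  assumes "p \<ge> 2" "a > 0"
  shows "(1 - 1 / real p) * a \<le> real (1 + (a - 1 - a div p))"
    and "real (1 + (a - 1 - a div p)) \<le> (1 - 1 / real p) * a + 1"
proof -
  \<comment> \<open>This makes the truncated subtractions exact.\<close>
  have "a div p < a" using assms by simp
  then have *: "real (1 + (a - 1 - a div p)) = real a - real (a div p)" by linarith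
  have "real (a div p) \<le> real a / real p" by (rule of_nat_div_le_of_nat)
  then show "(1 - 1 / real p) * a \<le> real (1 + (a - 1 - a div p))" unfolding * by (simp add: algebra_simps)
  have "a mod p < p" using assms by simp
  then have "a \<le> p * (a div p) + p" using mult_div_mod_eq[of p a] by linarith
  then have "real a \<le> real p * real (a div p) + real p" by (metis of_nat_add of_nat_le_iff of_nat_mult)
  then have "real a / real p \<le> real (a div p) + 1"
    using assms by (simp add: divide_le_eq algebra_simps)
  then show "real (1 + (a - 1 - a div p)) \<le> (1 - 1 / real p) * a + 1" unfolding * by (simp add: algebra_simps)
qed

section \<open>Convergence\<close>

lemma length_strata_indices: "j \<in> strata_indices p n \<Longrightarrow> length j = n"
  by (simp add: strata_indices_def)

text \<open>With all weights at most \<open>- \<delta>\<close>, the quantity compared with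
  \<open>N\<close> is at most \<open>n\<close> minus \<open>\<delta>\<close> times the sum of the
  increments. So \<open>N\<close> bounds the increments, hence the upper jumps and all entries of
  \<open>j\<close>.\<close>

lemma finite_connected_strata:
  assumes p: "p \<ge> 2" and n: "n \<ge> 1"
    and margin: "\<And>m. m < n \<Longrightarrow> 1 - 1 / real p ^ (n - m)
       - (\<Sum>l = m..<n. (\<Sum>d\<leftarrow>ds. D_indec p n d l) / real p ^ (2 * n - 1 - l)) < 0"
  shows "finite {j \<in> strata_indices p n. j ! 0 \<noteq> None \<and>
      int (stratum_dim p j) - (\<Sum>d\<leftarrow>ds. v_indec p n d j) > N}"
proof -
  define D where "D l = (\<Sum>d\<leftarrow>ds. D_indec p n d l)" for l
  define c where "c l = 1 - 1 / real p - D l / real p ^ n" for l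
  define T where "T = tail_weight (real p) n c"
  define \<delta> where "\<delta> = Min ((\<lambda>m. - T m) ` {..<n})"
  have T_neg: "T m < 0" if "m < n" for m
  proof -
    have "T m = real p ^ (n - m) / real p *
        (1 - 1 / real p ^ (n - m) - (\<Sum>l = m..<n. D l / real p ^ (2 * n - 1 - l)))"
      unfolding T_def c_def using that p by (intro tail_weight_margin) simp_all
    also have "\<dots> < 0" using margin[OF that] p unfolding D_def by (intro mult_pos_neg) simp_all
    finally show ?thesis .
  qed
  have \<delta>: "\<delta> > 0" "\<And>m. m < n \<Longrightarrow> T m \<le> - \<delta>"
  proof -
    have "\<delta> \<in> (\<lambda>m. - T m) ` {..<n}" unfolding \<delta>_def using n by (intro Min_in) (auto simp: lessThan_empty_iff)
    then show "\<delta> > 0" using T_neg by auto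
    have "\<delta> \<le> - T m" if "m < n" for m unfolding \<delta>_def using that by (intro Min_le) auto
    then show "T m \<le> - \<delta>" if "m < n" for m using that by fastforce
  qed
  \<comment> \<open>A bound for all entries of \<open>j\<close>, obtained from \<open>u_le\<close>
    and \<open>W\<close> below.\<close>
  define B where "B = nat \<lceil>real p ^ n * ((real n - real_of_int N) / \<delta>)\<rceil>"
  have "set j \<subseteq> insert None (Some ` {..B}) \<and> length j = n"
    if j: "j \<in> strata_indices p n" and j0: "j ! 0 \<noteq> None"
      and gt: "int (stratum_dim p j) - (\<Sum>d\<leftarrow>ds. v_indec p n d j) > N" for j
  proof -
    define u where "u m = real_of_int (upper_jump p j m)" for m
    define w where "w m = (if m = 0 then u 0 else u m - real p * u (m - 1))" for m
    have len: "length j = n" using j by (rule length_strata_indices)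
    have u_nonneg: "u m \<ge> 0" for m using upper_jump_props(1)[OF j0] by (simp add: u_def)
    have w_nonneg: "w m \<ge> 0" for m
    proof (cases m)
      case (Suc k)
      have "real p * u k \<le> u (Suc k)"
        unfolding u_def using upper_jump_props(3)[OF j0, where p = p and i = k]
        by (metis of_int_le_iff of_int_mult of_int_of_nat_eq)
      then show ?thesis by (simp add: w_def Suc)
    qed (simp add: w_def u_nonneg)
    have u_le: "u m \<le> real p ^ m * (\<Sum>k\<le>m. w k)" for m
    proof (induction m)
      case (Suc m)
      have "1 \<le> real p ^ Suc m" using p by (intro one_le_power) simp
      then have "w (Suc m) \<le> real p ^ Suc m * w (Suc m)"
        using mult_right_mono[of 1 "real p ^ Suc m" "w (Suc m)"] w_nonneg by simp
      have "u (Suc m) = w (Suc m) + real p * u m" by (simp add: w_def)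
      also have "\<dots> \<le> real p ^ Suc m * w (Suc m) + real p * (real p ^ m * (\<Sum>k\<le>m. w k))"
        using Suc \<open>w (Suc m) \<le> _\<close> by (intro add_mono mult_left_mono) simp_all
      finally show ?case by (simp add: algebra_simps)
    qed (simp add: w_def)
    have dim: "real (stratum_dim p j) \<le> (\<Sum>m<n. (1 - 1 / real p) * u m) + n"
    proof -
      \<comment> \<open>The summand \<open>1\<close> pays for the rounding in
        \<open>a div p\<close>; an entry \<open>None\<close> contributes \<open>0\<close>.\<close>
      have "(case j ! m of None \<Rightarrow> 0 | Some a \<Rightarrow> real (1 + (a - 1 - a div p))) \<le> (1 - 1 / real p) * u m + 1"
        if m: "m < n" for m
      proof (cases "j ! m")
        case None
        then show ?thesis using p u_nonneg[of m] by (simp add: add_nonneg_nonneg)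
      next
        case (Some a)
        then have "a > 0" using j m len by (auto simp: strata_indices_def in_set_conv_nth)
        have "real a \<le> u m"
          unfolding u_def using upper_jump_props(2)[OF j0 Some, of p] by linarith
        then have "(1 - 1 / real p) * a \<le> (1 - 1 / real p) * u m"
          using p by (intro mult_left_mono) auto
        then show ?thesis using stratum_term_bounds(2)[OF p \<open>a > 0\<close>] by (simp only: Some option.case)
      qed
      then have "real (stratum_dim p j) \<le> (\<Sum>m<n. (1 - 1 / real p) * u m + 1)"
        unfolding stratum_dim_nth len by (intro sum_mono) simp
      then show ?thesis by (simp add: sum.distrib)
    qed
    have "real_of_int N < real (stratum_dim p j) - real_of_int (\<Sum>d\<leftarrow>ds. v_indec p n d j)"
      using gt by (metis of_int_diff of_int_less_iff of_int_of_nat_eq)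
    also have "\<dots> \<le> (\<Sum>m<n. (1 - 1 / real p) * u m) + n - (\<Sum>m<n. u m * D m / real p ^ n)"
      using dim sum_list_v_indec_bounds(1)[of p n j ds] p n unfolding u_def D_def by linarith
    also have "\<dots> = n + (\<Sum>m<n. c m * u m)"
      by (simp add: c_def algebra_simps sum_subtractf)
    also have "(\<Sum>m<n. c m * u m) = (\<Sum>m<n. T m * w m)"
      unfolding T_def w_def by (rule tail_weight_summation[OF n])
    also have "\<dots> \<le> (\<Sum>m<n. - \<delta> * w m)"
      using \<delta>(2) w_nonneg by (intro sum_mono mult_right_mono) auto
    also have "\<dots> = - \<delta> * (\<Sum>m<n. w m)" by (simp add: sum_distrib_left)
    finally have W: "(\<Sum>m<n. w m) < (real n - real_of_int N) / \<delta>"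
      using \<delta>(1) by (simp add: field_simps)
    have "x \<in> insert None (Some ` {..B})" if x: "x \<in> set j" for x
    proof (cases x)
      case (Some a)
      then obtain m where m: "m < n" "j ! m = Some a" using x len by (auto simp: in_set_conv_nth)
      have "real a \<le> u m" unfolding u_def using upper_jump_props(2)[OF j0 m(2), of p] by linarith
      also have "\<dots> \<le> real p ^ m * (\<Sum>k\<le>m. w k)" by (rule u_le)
      also have "\<dots> \<le> real p ^ n * (\<Sum>k<n. w k)"
        using m p w_nonneg by (intro mult_mono power_increasing sum_mono2 sum_nonneg) auto
      also have "\<dots> \<le> real p ^ n * ((real n - real_of_int N) / \<delta>)"
        using W by (intro mult_left_mono) auto
      finally have "a \<le> B" unfolding B_def by linarith
      then show ?thesis using Some by simp
    qed simp
    with len show ?thesis by blast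
  qed
  then have "{j \<in> strata_indices p n. j ! 0 \<noteq> None \<and> int (stratum_dim p j) - (\<Sum>d\<leftarrow>ds. v_indec p n d j) > N}
      \<subseteq> {j. set j \<subseteq> insert None (Some ` {..B}) \<and> length j = n}" by blast
  then show ?thesis by (rule finite_subset) (intro finite_lists_length_eq; simp)
qed

text \<open>
  The witnesses have \<open>u\<^sub>0\<close> minimal, a large increment at \<open>m\<^sub>0\<close> and no other increments; each
  remaining \<open>j\<^sub>m\<close> takes the largest value prime to \<open>p\<close> that does not exceed \<open>u\<^sub>m\<close>.
\<close>

lemma infinite_connected_strata:
  assumes p: "p \<ge> 2" and m0: "m0 < n"
    and margin: "1 - 1 / real p ^ (n - m0)
       - (\<Sum>l = m0..<n. (\<Sum>d\<leftarrow>ds. D_indec p n d l) / real p ^ (2 * n - 1 - l)) \<ge> 0"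
  shows "\<exists>N. infinite {j \<in> strata_indices p n. j ! 0 \<noteq> None \<and>
      int (stratum_dim p j) - (\<Sum>d\<leftarrow>ds. v_indec p n d j) > N}"
proof -
  have n: "n \<ge> 1" using m0 by simp
  define D where "D l = (\<Sum>d\<leftarrow>ds. D_indec p n d l)" for l
  define c where "c l = 1 - 1 / real p - D l / real p ^ n" for l
  \<comment> \<open>The offset makes the jump at \<open>m0\<close> prime to \<open>p\<close>: it is
    \<open>1 + t * p\<close> if \<open>m0 = 0\<close> and \<open>p ^ m0 + t * p + 1\<close>
    otherwise.\<close>
  define b where "b = (if m0 = 0 then 0 else 1 :: nat)"
  \<comment> \<open>These will be the upper jumps: an increment \<open>1\<close> at \<open>0\<close>
    and an increment \<open>t * p + b\<close> at \<open>m0\<close>, multiplied by \<open>p\<close>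
    at each further index.\<close>
  define U where "U t m = p ^ m + (if m0 \<le> m then p ^ (m - m0) * (t * p + b) else 0)" for t m
  define a where "a t m = (if m = 0 \<or> m = m0 then U t m else U t m - 1)" for t m
  define J where "J t = map (\<lambda>m. Some (a t m)) [0..<n]" for t
  define C where "C = (\<Sum>d\<leftarrow>ds. real (card (digit_vectors p n d)))"
  \<comment> \<open>A lower bound independent of \<open>t\<close>: the loss \<open>n\<close> covers
    the entries \<open>U t m - 1\<close>, and \<open>C\<close> covers the ceilings.\<close>
  define K where "K = (\<Sum>m<n. c m * real (p ^ m)) - n - C"
  have nth: "J t ! m = Some (a t m)" if "m < n" for t m using that by (simp add: J_def)
  have U_pos: "U t m \<ge> 1" for t m using p by (simp add: U_def trans_le_add1)
  have p_dvd_U: "p dvd U t m" if "m \<noteq> 0" "m \<noteq> m0" for t m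
    using that unfolding U_def by (auto intro!: dvd_add dvd_mult2 dvd_power)
  have not_dvd: "\<not> p dvd 1 + p * y" for y
  proof
    assume "p dvd 1 + p * y"
    then have "p dvd 1" by (subst (asm) dvd_add_left_iff) simp_all
    then show False using p by simp
  qed
  have a_ok: "a t m > 0 \<and> \<not> p dvd a t m" for t m
  proof (cases "m = 0 \<or> m = m0")
    case True
    have "\<not> p dvd U t m"
    proof (cases "m = 0")
      case True
      have "U t m = 1 + p * t \<or> U t m = 1 + p * 0" using True by (auto simp: U_def b_def)
      then show ?thesis using not_dvd by metis
    next
      case False
      with \<open>m = 0 \<or> m = m0\<close> have "m = m0" "m0 \<noteq> 0" by auto
      then have "U t m = 1 + (p * (p ^ (m0 - 1) + t))"
        by (simp add: U_def b_def algebra_simps flip: power_Suc)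
      then show ?thesis using not_dvd by metis
    qed
    then show ?thesis using True U_pos[of t m] by (simp add: a_def)
  next
    case False
    then have "p dvd U t m" using p_dvd_U by simp
    with U_pos[of t m] have "U t m \<ge> p" by (simp add: dvd_imp_le)
    moreover have "\<not> p dvd U t m - 1"
    proof
      assume "p dvd U t m - 1"
      then have "p dvd U t m - (U t m - 1)" using \<open>p dvd U t m\<close> by (rule dvd_diff_nat[rotated])
      then show False using U_pos[of t m] p by simp
    qed
    ultimately show ?thesis using False p by (simp add: a_def)
  qed
  have a_le: "a t m \<le> U t m" for t m by (simp add: a_def)
  have a_ge: "real (a t m) \<ge> real (U t m) - 1" for t m using U_pos[of t m] by (simp add: a_def)
  have J_strata: "J t \<in> strata_indices p n" for t
    using a_ok by (auto simp: strata_indices_def J_def)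
  have U_mono: "p ^ (i - m) * U t m \<le> U t i" if "m \<le> i" for t m i
  proof -
    have "p ^ (i - m) * (p ^ (m - m0) * (t * p + b)) = p ^ (i - m0) * (t * p + b)" if "m0 \<le> m"
      using that \<open>m \<le> i\<close> by (simp add: mult.assoc[symmetric] flip: power_add)
    moreover have "p ^ (i - m) * p ^ m = p ^ i" using that by (simp flip: power_add)
    ultimately show ?thesis using that by (auto simp: U_def distrib_left)
  qed
  have upper: "upper_jump p (J t) i = int (U t i)" if i: "i < n" for t i
    unfolding upper_jump_def
  proof (rule Max_eqI)
    show "finite {int (p ^ (i - m) * x) | m x. m \<le> i \<and> J t ! m = Some x}"
      by (rule finite_subset[of _ "(\<lambda>m. int (p ^ (i - m) * the (J t ! m))) ` {..i}"]) force+
    fix y assume "y \<in> {int (p ^ (i - m) * x) | m x. m \<le> i \<and> J t ! m = Some x}"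
    then obtain m x where y: "y = int (p ^ (i - m) * x)" and m: "m \<le> i" and "J t ! m = Some x" by blast
    then have "x = a t m" using i nth[of m t] by simp
    then have "p ^ (i - m) * x \<le> p ^ (i - m) * U t m" using a_le by simp
    also have "\<dots> \<le> U t i" using m by (rule U_mono)
    finally show "y \<le> int (U t i)" unfolding y by (simp only: of_nat_le_iff)
  next
    \<comment> \<open>The maximum is attained at the last index with an increment:
      \<open>m0\<close>, or \<open>0\<close> before it is reached.\<close>
    define m where "m = (if m0 \<le> i then m0 else 0)"
    have "m \<le> i" "p ^ (i - m) * U t m = U t i" by (auto simp: m_def U_def distrib_left simp flip: power_add)
    moreover have "J t ! m = Some (U t m)" using i nth[of m t] \<open>m \<le> i\<close> by (auto simp: m_def a_def)
    ultimately show "int (U t i) \<in> {int (p ^ (i - m) * x) | m x. m \<le> i \<and> J t ! m = Some x}"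
      by (intro CollectI exI[of _ m] exI[of _ "U t m"]) simp
  qed
  have main: "K \<le> real (stratum_dim p (J t)) - real_of_int (\<Sum>d\<leftarrow>ds. v_indec p n d (J t))" for t
  proof -
    have term_bound: "(1 - 1 / real p) * real (U t m) - 1 \<le> real (1 + (a t m - 1 - a t m div p))" for m
    proof -
      have "(1 - 1 / real p) * real (U t m) - 1 \<le> (1 - 1 / real p) * (real (U t m) - 1)"
        by (simp add: algebra_simps)
      also have "\<dots> \<le> (1 - 1 / real p) * real (a t m)"
        using p a_ge by (intro mult_left_mono) auto
      also have "\<dots> \<le> real (1 + (a t m - 1 - a t m div p))"
        using stratum_term_bounds(1)[OF p] a_ok by blast
      finally show ?thesis .
    qed
    have "(\<Sum>m<n. (1 - 1 / real p) * real (U t m) - 1) \<le> (\<Sum>m<n. real (1 + (a t m - 1 - a t m div p)))"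
      by (intro sum_mono term_bound)
    also have "\<dots> = real (stratum_dim p (J t))"
      unfolding stratum_dim_nth length_strata_indices[OF J_strata]
      by (intro sum.cong refl) (simp only: nth lessThan_iff option.case)
    finally have "(\<Sum>m<n. (1 - 1 / real p) * real (U t m) - 1) \<le> real (stratum_dim p (J t))" .
    moreover have "real_of_int (\<Sum>d\<leftarrow>ds. v_indec p n d (J t)) \<le> (\<Sum>m<n. real (U t m) * D m / real p ^ n) + C"
      using sum_list_v_indec_bounds(2)[of p n "J t" ds] p n
      unfolding C_def D_def by (simp add: upper)
    moreover have "(\<Sum>m<n. c m * real (U t m)) = (\<Sum>m<n. (1 - 1 / real p) * real (U t m) - 1) + n
        - (\<Sum>m<n. real (U t m) * D m / real p ^ n)"
      by (simp add: c_def algebra_simps sum_subtractf)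
    \<comment> \<open>The part growing with \<open>t\<close> is \<open>t * p + b\<close> times the
      tail weight at \<open>m0\<close>, which is nonnegative by hypothesis.\<close>
    moreover have "(\<Sum>m<n. c m * real (p ^ m)) \<le> (\<Sum>m<n. c m * real (U t m))"
    proof -
      have "(\<Sum>m<n. c m * real (U t m)) = (\<Sum>m<n. c m * real (p ^ m))
         + (\<Sum>m<n. if m0 \<le> m then real (t * p + b) * (real p ^ (m - m0) * c m) else 0)"
        unfolding sum.distrib[symmetric] by (intro sum.cong refl) (simp add: U_def algebra_simps)
      also have "(\<Sum>m<n. if m0 \<le> m then real (t * p + b) * (real p ^ (m - m0) * c m) else 0)
         = real (t * p + b) * tail_weight (real p) n c m0"
        unfolding tail_weight_def sum_distrib_left
        by (subst sum.inter_filter[symmetric]) (auto intro!: sum.cong)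
      finally have "(\<Sum>m<n. c m * real (U t m)) =
        (\<Sum>m<n. c m * real (p ^ m)) + real (t * p + b) * tail_weight (real p) n c m0" .
      moreover have "tail_weight (real p) n c m0 = real p ^ (n - m0) / real p *
          (1 - 1 / real p ^ (n - m0) - (\<Sum>l = m0..<n. D l / real p ^ (2 * n - 1 - l)))"
        unfolding c_def using p m0 by (intro tail_weight_margin) simp_all
      then have "tail_weight (real p) n c m0 \<ge> 0"
        using margin unfolding D_def by (simp only:) (intro mult_nonneg_nonneg divide_nonneg_nonneg; simp)
      then have "real (t * p + b) * tail_weight (real p) n c m0 \<ge> 0" by (intro mult_nonneg_nonneg) auto
      ultimately show ?thesis by linarith
    qed
    ultimately show ?thesis unfolding K_def by linarith
  qed
  \<comment> \<open>The integer \<open>\<lfloor>K\<rfloor> - 1\<close> lies strictly below all these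
    differences.\<close>
  have "J t \<in> {j \<in> strata_indices p n. j ! 0 \<noteq> None \<and>
      int (stratum_dim p j) - (\<Sum>d\<leftarrow>ds. v_indec p n d j) > \<lfloor>K\<rfloor> - 1}" for t
    using main[of t] J_strata[of t] nth[of 0 t] n by simp linarith
  moreover have "inj J"
  proof (rule injI)
    fix s t assume "J s = J t"
    then have "a s m0 = a t m0" using nth[OF m0, of s] nth[OF m0, of t] by simp
    then show "s = t" using p by (simp add: a_def U_def)
  qed
  ultimately have "infinite {j \<in> strata_indices p n. j ! 0 \<noteq> None \<and>
      int (stratum_dim p j) - (\<Sum>d\<leftarrow>ds. v_indec p n d j) > \<lfloor>K\<rfloor> - 1}"
    using infinite_super[of "range J"] range_inj_infinite by blast
  then show ?thesis by blast
qed

section \<open>Covers with arbitrary stabilizer\<close>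

lemma GCov_stratum_nonempty:
  assumes "j \<in> strata_indices p n"
  shows "GCov_stratum p n j \<noteq> ({} :: 'k::field fls list set)"
proof -
  \<comment> \<open>Monomials suffice: one with exponent \<open>- a\<close>, where \<open>a\<close>
    is positive and prime to \<open>p\<close>, is reduced and has pole order
    \<open>a\<close>.\<close>
  define f :: "nat option \<Rightarrow> 'k fls" where
    "f x = (case x of None \<Rightarrow> 0 | Some a \<Rightarrow> fls_X_intpow (- int a))" for x
  have "reduced p (f x) \<and> pole_order (f x) = x" if "x \<in> set j" for x
  proof (cases x)
    case (Some a)
    with that assms have a: "a > 0" "\<not> p dvd a" by (auto simp: strata_indices_def)
    have "(fls_X_intpow (- int a) :: 'k fls) \<noteq> 0" by (rule fls_X_intpow_nonzero)
    moreover have "e < 0 \<and> \<not> int p dvd e" if "fls_nth (fls_X_intpow (- int a) :: 'k fls) e \<noteq> 0" for e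
    proof -
      have "e = - int a" using that by (auto split: if_splits)
      then show ?thesis using a by simp
    qed
    ultimately show ?thesis unfolding Some f_def reduced_def pole_order_def option.case by simp
  qed (simp add: f_def reduced_def pole_order_def)
  then have "map f j \<in> GCov_stratum p n j"
    using length_strata_indices[OF assms] by (auto simp: GCov_stratum_def GCov_def map_idI)
  then show ?thesis by blast
qed

text \<open>The pole orders decide which entries of \<open>E\<close> vanish, so the least index in
  \<open>v_fun\<close> is \<open>r\<close>, and the value depends on \<open>E\<close> only through
  \<open>j\<close>.\<close>

lemma v_fun_eq:
  fixes \<rho> :: "int \<Rightarrow> 'k::field mat"
  assumes E: "E \<in> GCov_stratum p n j" and r: "r < n" "j ! r \<noteq> None" "\<And>i. i < r \<Longrightarrow> j ! i = None"
  shows "v_fun p n \<rho> E =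
    (\<Sum>d\<leftarrow>summand_dims (p ^ (n - r)) (restrict_rep (p ^ r) \<rho>). v_indec p (n - r) d (drop r j))"
proof -
  have len: "length E = n" and j: "map pole_order E = j"
    using E by (auto simp: GCov_stratum_def GCov_def)
  have "E ! i \<noteq> 0 \<longleftrightarrow> j ! i \<noteq> None" if "i < n" for i
    using that len j by (auto simp: pole_order_def)
  then have "(LEAST r. r < n \<and> E ! r \<noteq> 0) = r"
    using r by (intro Least_equality) (auto simp: not_less[symmetric])
  moreover have "(\<forall>f \<in> set E. f = 0) = False"
    using r len \<open>\<And>i. i < n \<Longrightarrow> E ! i \<noteq> 0 \<longleftrightarrow> j ! i \<noteq> None\<close>[of r] nth_mem[of r E] by auto
  ultimately show ?thesis unfolding v_fun_def v_connected_def Let_def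
    by (simp only: if_False j flip: drop_map)
qed

lemma stratum_dim_replicate_None: "stratum_dim p (replicate r None @ j) = stratum_dim p j"
  by (simp add: stratum_dim_def sum_list_replicate)

theorem theorem1p1:
  fixes \<rho> :: "int \<Rightarrow> 'k::alg_closed_field mat" and p n d :: nat
  assumes "CHAR('k) = p" and "p > 0" and "n \<ge> 1"
    and "cyclic_rep (p ^ n) d \<rho>"
  shows "integral_converges p n d \<rho> \<longleftrightarrow>
    (\<forall>m<n. 1 - 1 / real p ^ (n - m)
             - (\<Sum>l = m..<n. D_inv p n \<rho> l / real p ^ (2 * n - 1 - l)) < 0)"
proof -
  have prime: "prime CHAR('k)" using assms(1,2) prime_CHAR_semidom[where ?'a = 'k] by simp
  then have p: "p \<ge> 2" using assms(1) prime_ge_2_nat by blast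
  define margin where "margin m = 1 - 1 / real p ^ (n - m)
      - (\<Sum>l = m..<n. D_inv p n \<rho> l / real p ^ (2 * n - 1 - l))" for m
  define A where "A N = {j \<in> strata_indices p n.
        \<exists>E \<in> GCov_stratum p n j. int (stratum_dim p j) + int d - v_fun p n \<rho> E > N}" for N
  define ds where "ds r = summand_dims (p ^ (n - r)) (restrict_rep (p ^ r) \<rho>)" for r
  \<comment> \<open>\<open>B r\<close> concerns connected covers for the subgroup of index
    \<open>p ^ r\<close>; the constant \<open>d\<close> is left out and reappears as a shift of
    \<open>N\<close>.\<close>
  define B where "B r N = {j \<in> strata_indices p (n - r). j ! 0 \<noteq> None \<and>
      int (stratum_dim p j) - (\<Sum>d\<leftarrow>ds r. v_indec p (n - r) d j) > N}" for r N
  have ds0: "ds 0 = summand_dims (p ^ n) \<rho>" by (simp add: ds_def restrict_rep_def)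
  have v: "v_fun p n \<rho> E = (\<Sum>d\<leftarrow>ds r. v_indec p (n - r) d (drop r j))"
    if "E \<in> GCov_stratum p n j" "r < n" "j ! r \<noteq> None" "\<And>i. i < r \<Longrightarrow> j ! i = None" for E j r
    unfolding ds_def using that by (rule v_fun_eq)
  have "integral_converges p n d \<rho> \<longleftrightarrow> (\<forall>N. finite (A N))"
    unfolding integral_converges_def A_def ..
  also have "\<dots> \<longleftrightarrow> (\<forall>m<n. margin m < 0)"
  proof (intro iffI allI impI)
    fix m assume fin: "\<forall>N. finite (A N)" and m: "m < n"
    show "margin m < 0"
    proof (rule ccontr)
      assume "\<not> margin m < 0"
      \<comment> \<open>A failing inequality is already detected by the connected covers, the case
        \<open>r = 0\<close>.\<close>
      then obtain N where inf: "infinite (B 0 N)"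
        using infinite_connected_strata[OF p m, of "ds 0"]
        unfolding B_def margin_def D_inv_def ds0 by auto
      have "B 0 N \<subseteq> A (N + int d)"
      proof
        fix j assume j: "j \<in> B 0 N"
        then obtain E :: "'k fls list" where E: "E \<in> GCov_stratum p n j"
          using GCov_stratum_nonempty[of j p n] by (auto simp: B_def)
        have "v_fun p n \<rho> E = (\<Sum>d\<leftarrow>ds 0. v_indec p n d j)"
          using v[OF E, of 0] j m by (simp add: B_def)
        then show "j \<in> A (N + int d)" using j E unfolding A_def B_def by force
      qed
      with fin inf show False using finite_subset by blast
    qed
  next
    fix N assume neg: "\<forall>m<n. margin m < 0"
    \<comment> \<open>The inequalities of each restricted representation are among the assumed ones:
      its \<open>m\<close>-th is that at \<open>m + r\<close>.\<close>
    have fin: "finite (B r N')" if r: "r < n" for r N'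
    proof -
      have gt1: "CHAR('k) ^ s > 1" if "s > 0" for s
        using that prime_gt_1_nat[OF prime] one_less_power by blast
      have rep: "cyclic_rep (p ^ (n - r)) d (restrict_rep (p ^ r) \<rho>)"
        using assms(1,2,4) r gt1[of "n - r"]
        by (intro cyclic_rep_restrict) (simp_all flip: power_add)
      have es: "\<forall>e \<in> set (ds r). e \<le> p ^ (n - r)"
        unfolding ds_def using rep r gt1[of "n - r"] assms(1)
        by (intro summand_dims(2)[OF prime]) auto
      have ds0_le: "\<forall>e \<in> set (ds 0). e \<le> p ^ n"
        unfolding ds0 using assms gt1[of n] by (intro summand_dims(2)[OF prime]) auto
      have eq: "(\<Sum>e\<leftarrow>ds r. min k e) = (\<Sum>d\<leftarrow>ds 0. min (p ^ r * k) d)" for k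
        unfolding ds0 unfolding ds_def using summand_dims_restrict_min[OF prime r] assms(1,4) by simp
      have D: "(\<Sum>d\<leftarrow>ds r. D_indec p (n - r) d l) = D_inv p n \<rho> (l + r) / real p ^ r" if "l < n - r" for l
        using sum_list_D_indec_restrict[OF assms(2) r that ds0_le es eq] by (simp add: D_inv_def ds0)
      show ?thesis unfolding B_def
      proof (rule finite_connected_strata[OF p])
        fix m assume m: "m < n - r"
        show "1 - 1 / real p ^ (n - r - m)
          - (\<Sum>l = m..<n - r. (\<Sum>d\<leftarrow>ds r. D_indec p (n - r) d l) / real p ^ (2 * (n - r) - 1 - l)) < 0"
          (is "?M < 0")
        proof -
          have "?M = margin (m + r)"
            unfolding margin_def using D by (rule margin_restrict[OF assms(2) r m])
          then show ?thesis using neg m by simp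
        qed
      qed (use r in simp)
    qed
    \<comment> \<open>Apart from the trivial cover, an index consists of \<open>r\<close> leading
      entries \<open>None\<close> and a connected index for the subgroup, with finitely many choices
      of \<open>r\<close>.\<close>
    have "A N \<subseteq> {replicate n None} \<union> (\<Union>r<n. (\<lambda>j. replicate r None @ j) ` B r (N - int d))"
    proof
      fix j assume "j \<in> A N"
      then obtain E :: "'k fls list" where j: "j \<in> strata_indices p n" and E: "E \<in> GCov_stratum p n j"
        and gt: "int (stratum_dim p j) + int d - v_fun p n \<rho> E > N" by (auto simp: A_def)
      have len: "length j = n" using j by (rule length_strata_indices)
      show "j \<in> {replicate n None} \<union> (\<Union>r<n. (\<lambda>j. replicate r None @ j) ` B r (N - int d))"
      proof (cases "\<forall>i<n. j ! i = None")
        case True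
        then have "j = replicate n None" using len by (intro nth_equalityI) auto
        then show ?thesis by simp
      next
        case False
        define r where "r = (LEAST i. i < n \<and> j ! i \<noteq> None)"
        have r: "r < n" "j ! r \<noteq> None"
          using False LeastI_ex[of "\<lambda>i. i < n \<and> j ! i \<noteq> None"] unfolding r_def by auto
        have below: "j ! i = None" if "i < r" for i
          using that r(1) not_less_Least[of i "\<lambda>i. i < n \<and> j ! i \<noteq> None"] unfolding r_def by auto
        have split: "j = replicate r None @ drop r j"
        proof -
          have "take r j = replicate r None" using below r len by (intro nth_equalityI) auto
          then show ?thesis by (metis append_take_drop_id)
        qed
        have "stratum_dim p (drop r j) = stratum_dim p j"
          by (subst (2) split) (simp add: stratum_dim_replicate_None)
        then have "drop r j \<in> B r (N - int d)"
          using v[OF E r below] gt j r len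
          by (auto simp: B_def strata_indices_def dest: in_set_dropD)
        then show ?thesis using split r(1) by blast
      qed
    qed
    moreover have "finite ({replicate n None} \<union> (\<Union>r<n. (\<lambda>j. replicate r None @ j) ` B r (N - int d)))"
      using fin by blast
    ultimately show "finite (A N)" by (rule finite_subset)
  qed
  finally show ?thesis unfolding margin_def .
qed

end
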